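(* Let $f_1,\ldots,f_N:\mathbb{R}^n\to\mathbb{R}$ be locally Lipschitz and subdifferentially regular, and let $f=(f_1+\cdots+f_N)/N$. Then random reshuffling with momentum, with momentum parameters $\beta\in(-1,1)$, $\gamma\in\mathbb{R}$ and constant $\delta>0$, is approximated by subgradient trajectories of $f$ up to the multiplicative constant $c=N/(1-\beta)$.
   Context: Notation: $\mathbb{N}=\{0,1,2,\ldots\}$; $\langle\cdot,\cdot\rangle$ is an inner product on $\mathbb{R}^n$ with induced norm $\|\cdot\|$; $\lfloor\cdot\rfloor$ is the floor function. Clarke subdifferential: for $g:\mathbb{R}^n\to\mathbb{R}$ locally Lipschitz, $\partial g(x) := \{ s \in \mathbb{R}^n : g^\circ(x,d) \geqslant \langle s , d \rangle\ \forall d\in \mathbb{R}^n \}$, where $g^\circ(x,d) := \limsup_{y\to x,\, t\searrow 0} \frac{g(y+td)-g(y)}{t}$. A locally Lipschitz function $g$ is subdifferentially regular if for all $x,h\in\mathbb{R}^n$ the limit $\lim_{t\searrow 0}\frac{g(x+th)-g(x)}{t}$ exists and equals $g^\circ(x,h)$. Random reshuffling with momentum: given a step size $\alpha>0$, $\beta\in(-1,1)$, $\gamma\in\mathbb{R}$, $\delta>0$, choose $x_{-1,N-1},x_0\in\mathbb{R}^n$ with $\|x_{-1,N-1}-x_0\|\leqslant\delta\alpha$. For $k=0,1,\ldots$: set $x_{k,0}=x_k$ and $x_{k,-1}=x_{k-1,N-1}$; choose an arbitrary permutation $\sigma^k$ of $\{1,\ldots,N\}$; for $i=1,\ldots,N$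 set $y_{k,i}=x_{k,i-1}+\gamma(x_{k,i-1}-x_{k,i-2})$ and choose $x_{k,i}\in x_{k,i-1}+\beta(x_{k,i-1}-x_{k,i-2})-\alpha\,\partial f_{\sigma^k_i}(y_{k,i})$; then set $x_{k+1}=x_{k,N}$. For fixed $\beta,\gamma,\delta$, and for $\alpha>0$, $X_0\subset\mathbb{R}^n$, $\bar{k}\in\mathbb{N}$, let $\mathcal{M}(f,\alpha,X_0,\bar{k})$ be the set of all sequences $(x_k)_{k\in\mathbb{N}}$ generated by this algorithm with step size $\alpha$ (over all admissible choices of initial points, permutations and subgradients) such that $x_{\bar{k}}\in X_0$. The method is approximated by subgradient trajectories of $f$ up to the multiplicative constant $c>0$ if for any compact sets $X_0,X_1\subset\mathbb{R}^n$ there exists $T>0$ such that for all $\epsilon>0$ there exists $\bar{\alpha}>0$ such that for all $\alpha\in(0,\bar{\alpha}]$, $\bar{k}\in\mathbb{N}$, and $(x_k)_{k\in\mathbb{N}}\in\mathcal{M}(f,\alpha,X_0,\bar{k})$ for which $x_0,\ldots,x_{\bar{k}}\in X_1$, there exists an absolutely continuous function $x:[0,T]\to\mathbb{R}^n$ such that $x'(t)\in -c\,\partial f(x(t))$ for almost every $t\in[0,T]$, $x(0)\in X_0$, and $\|x_k-x((k-\bar{k})\alpha)\|\leqslant\epsilon$ for $k=\bar{k},\ldots,\bar{k}+\lfloor T/\alpha\rfloor$. *)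

theory Defs
  imports "HOL-Analysis.Analysis"
begin

definition locally_lipschitz :: "('a::metric_space \<Rightarrow> 'b::metric_space) \<Rightarrow> bool" where
  "locally_lipschitz g \<longleftrightarrow> (\<forall>x. \<exists>r>0. \<exists>L. L-lipschitz_on (ball x r) g)"

(* The points y range over full neighbourhoods of x (y = x is allowed). The limit superior
   is taken in ereal, so that it is the true one even where it is infinite. *)
definition clarke_dir_deriv :: "('a::real_normed_vector \<Rightarrow> real) \<Rightarrow> 'a \<Rightarrow> 'a \<Rightarrow> ereal" where
  "clarke_dir_deriv g x d =
     Limsup (nhds x \<times>\<^sub>F at_right 0) (\<lambda>(y, t). ereal ((g (y + t *\<^sub>R d) - g y) / t))"

definition clarke_subdiff :: "('a::real_inner \<Rightarrow> real) \<Rightarrow> 'a \<Rightarrow> 'a set" where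
  "clarke_subdiff g x = {s. \<forall>d. clarke_dir_deriv g x d \<ge> ereal (s \<bullet> d)}"

definition subdifferentially_regular :: "('a::real_normed_vector \<Rightarrow> real) \<Rightarrow> bool" where
  "subdifferentially_regular g \<longleftrightarrow>
     locally_lipschitz g \<and>
     (\<forall>x h. \<exists>l. ((\<lambda>t. (g (x + t *\<^sub>R h) - g x) / t) \<longlongrightarrow> l) (at_right 0) \<and>
                clarke_dir_deriv g x h = ereal l)"

definition absolutely_continuous_on :: "real set \<Rightarrow> (real \<Rightarrow> 'a::metric_space) \<Rightarrow> bool" where
  "absolutely_continuous_on I x \<longleftrightarrow>
     (\<forall>\<epsilon>>0. \<exists>\<delta>>0. \<forall>D :: (real \<times> real) set.
        finite D \<longrightarrow>
        (\<forall>(a, b)\<in>D. a < b \<and> {a..b} \<subseteq> I) \<longrightarrow>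
        pairwise (\<lambda>(a, b) (a', b'). disjnt {a<..<b} {a'<..<b'}) D \<longrightarrow>
        (\<Sum>(a, b)\<in>D. b - a) < \<delta> \<longrightarrow>
        (\<Sum>(a, b)\<in>D. dist (x a) (x b)) < \<epsilon>)"

(* Absolutely continuous x on [0,T] with x'(t) in - c * (subdifferential of f at x(t)) a.e.
   The derivative is taken within [0,T], so values of x outside [0,T] are irrelevant. *)
definition subgradient_trajectory ::
  "('a::euclidean_space \<Rightarrow> real) \<Rightarrow> real \<Rightarrow> real \<Rightarrow> (real \<Rightarrow> 'a) \<Rightarrow> bool" where
  "subgradient_trajectory f c T x \<longleftrightarrow>
     absolutely_continuous_on {0..T} x \<and>
     (AE t in lebesgue_on {0..T}.
        \<exists>s\<in>clarke_subdiff f (x t). (x has_vector_derivative - (c *\<^sub>R s)) (at t within {0..T}))"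

(* z k i is the inner iterate x_{k,i} for -1 <= i <= N, whence the integer index; in particular
   z 0 (-1) is the initial point x_{-1,N-1}. The components are F 1, ..., F N. *)
definition rrm_sequences ::
  "real \<Rightarrow> real \<Rightarrow> real \<Rightarrow> nat \<Rightarrow> (nat \<Rightarrow> 'a::euclidean_space \<Rightarrow> real) \<Rightarrow> real \<Rightarrow> (nat \<Rightarrow> 'a) set" where
  "rrm_sequences \<beta> \<gamma> \<delta> N F \<alpha> =
     {x. \<exists>(z :: nat \<Rightarrow> int \<Rightarrow> 'a) (\<sigma> :: nat \<Rightarrow> nat \<Rightarrow> nat).
        norm (z 0 (-1) - x 0) \<le> \<delta> * \<alpha> \<and>
        (\<forall>k. z (Suc k) (-1) = z k (int N - 1)) \<and>
        (\<forall>k. z k 0 = x k) \<and>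
        (\<forall>k. \<sigma> k permutes {1..N}) \<and>
        (\<forall>k. \<forall>i\<in>{1..N}.
           let u = z k (int i - 1); v = z k (int i - 2); y = u + \<gamma> *\<^sub>R (u - v)
           in \<exists>s\<in>clarke_subdiff (F (\<sigma> k i)) y.
                z k (int i) = u + \<beta> *\<^sub>R (u - v) - \<alpha> *\<^sub>R s) \<and>
        (\<forall>k. x (Suc k) = z k (int N))}"

definition rrm_method ::
  "real \<Rightarrow> real \<Rightarrow> real \<Rightarrow> nat \<Rightarrow> (nat \<Rightarrow> 'a::euclidean_space \<Rightarrow> real) \<Rightarrow>
     real \<Rightarrow> 'a set \<Rightarrow> nat \<Rightarrow> (nat \<Rightarrow> 'a) set" where
  "rrm_method \<beta> \<gamma> \<delta> N F \<alpha> X0 kbar = {x \<in> rrm_sequences \<beta> \<gamma> \<delta> N F \<alpha>. x kbar \<in> X0}"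

(* M \<alpha> X0 kbar is the set of sequences generated with step size \<alpha> that lie in X0 at index kbar. *)
definition approximated_by_subgradient_trajectories ::
  "(real \<Rightarrow> 'a set \<Rightarrow> nat \<Rightarrow> (nat \<Rightarrow> 'a) set) \<Rightarrow> ('a::euclidean_space \<Rightarrow> real) \<Rightarrow> real \<Rightarrow> bool" where
  "approximated_by_subgradient_trajectories M f c \<longleftrightarrow>
     c > 0 \<and>
     (\<forall>X0 X1. compact X0 \<longrightarrow> compact X1 \<longrightarrow>
        (\<exists>T>0. \<forall>\<epsilon>>0. \<exists>\<alpha>bar>0. \<forall>\<alpha>\<in>{0<..\<alpha>bar}. \<forall>kbar. \<forall>xs\<in>M \<alpha> X0 kbar.
           (\<forall>k\<le>kbar. xs k \<in> X1) \<longrightarrow>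
           (\<exists>x. subgradient_trajectory f c T x \<and> x 0 \<in> X0 \<and>
              (\<forall>k\<in>{kbar..kbar + nat \<lfloor>T / \<alpha>\<rfloor>}.
                 norm (xs k - x (real (k - kbar) * \<alpha>)) \<le> \<epsilon>))))"

end

theory Submission
  imports Defs "HOL-Complex_Analysis.Great_Picard"
begin

text \<open>
  Summing the momentum recursion over epochs telescopes: up to boundary terms of size \<open>O(\<alpha>)\<close>,
  \<open>(1 - \<beta>) (x\<^sub>b - x\<^sub>a)\<close> is \<open>- \<alpha>\<close> times the sum of all subgradients used in between. If the statement
  failed for some \<open>\<epsilon>\<close>, there would be bad runs with \<open>\<alpha> \<rightarrow> 0\<close>; by Arzela-Ascoli their interpolations
  converge along a subsequence to a Lipschitz curve \<open>x\<close>, which is differentiable almost everywhere.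
  At such a point \<open>t\<close>, upper semicontinuity of the Clarke directional derivatives bounds
  \<open>- x'(t) \<bullet> d\<close> by \<open>1 / (1 - \<beta>)\<close> times the sum of the \<open>f\<^sub>i\<^sup>\<circ>(x(t), d)\<close>. Regularity turns the latter
  into \<open>N f\<^sup>\<circ>(x(t), d)\<close>, which is the differential inclusion tested in the direction \<open>d\<close>; weak limits of
  subgradients are not needed. So \<open>x\<close> is a subgradient trajectory close to one of the bad runs.
\<close>

subsection \<open>Almost everywhere differentiability of Lipschitz curves\<close>

text \<open>Nothing is assumed about the iterates after index \<open>kbar\<close>, while
  subgradients are bounded only on bounded sets. The horizon is therefore short:
  \<open>T = 1 / (N * C)\<close>, where \<open>C * \<alpha>\<close> bounds every inner step, so that
  within it the iterates leave the ball containing \<open>X1\<close> by at most 1. The hypothesis on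
  the past serves the momentum: it carries the bound on the velocity from index 0 up to
  \<open>kbar\<close>. The boundary terms are O(\<alpha>) whatever the number of epochs, but the
  velocity of the limit divides by the length h of a time window. Hence h stays fixed while \<alpha>
  tends to 0, and only then does h shrink. The Clarke subdifferential is defined by inequalities,
  one for each direction d, so each d can be treated alone. For a sum, the Clarke derivative is in
  general only at most the sum of the Clarke derivatives; the inclusion needs the reverse
  inequality, and this is what regularity provides.\<close>

lemma mono_sum_disjoint_intervals_le:
  fixes H :: "real \<Rightarrow> real"
  assumes "mono H" "finite D"
    and "pairwise (\<lambda>(u, v) (u', v'). disjnt {u<..<v} {u'<..<v'}) D"
    and "\<And>u v. (u, v) \<in> D \<Longrightarrow> u < v \<and> a \<le> u \<and> v \<le> b" "a \<le> b"
  shows "(\<Sum>(u, v)\<in>D. H v - H u) \<le> H b - H a"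
proof -
  have "(\<forall>(u, v)\<in>D. u < v \<and> a \<le> u \<and> v \<le> c) \<longrightarrow>
      pairwise (\<lambda>(u, v) (u', v'). disjnt {u<..<v} {u'<..<v'}) D \<longrightarrow> a \<le> c \<longrightarrow>
      (\<Sum>(u, v)\<in>D. H v - H u) \<le> H c - H a" for c
    using assms(2)
  \<comment> \<open>Intervals are added by increasing left endpoint. All earlier ones end before the
    new one begins, so the induction hypothesis applies with its left endpoint as right end; this is
    why \<open>c\<close> varies.\<close>
  proof (induction D arbitrary: c rule: finite_ranking_induct[where f = fst])
    case empty
    then show ?case using monoD[OF \<open>mono H\<close>] by simp
  next
    case (insert p S)
    show ?case
    proof (cases "p \<in> S")
      case True
      then show ?thesis using insert by (simp add: insert_absorb)
    next
      case False
      show ?thesis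
      proof (intro impI)
        assume iv: "\<forall>(u, v)\<in>insert p S. u < v \<and> a \<le> u \<and> v \<le> c"
          and pw: "pairwise (\<lambda>(u, v) (u', v'). disjnt {u<..<v} {u'<..<v'}) (insert p S)"
          and "a \<le> c"
        obtain x y where p: "p = (x, y)" by force
        have xy: "x < y" "a \<le> x" "y \<le> c" using iv p by auto
        have "v \<le> x" if "(u, v) \<in> S" for u v
        proof (rule ccontr)
          assume "\<not> v \<le> x"
          moreover have "u \<le> x" using insert.hyps(2)[OF that] p by simp
          moreover have "disjnt {u<..<v} {x<..<y}"
            using pairwiseD[OF pw insertI2[OF that] insertI1] that False p by auto
          ultimately have "(x + min v y) / 2 \<in> {u<..<v} \<inter> {x<..<y}" using xy by auto
          then show False using \<open>disjnt {u<..<v} {x<..<y}\<close> by (auto simp: disjnt_def)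
        qed
        then have "\<forall>(u, v)\<in>S. u < v \<and> a \<le> u \<and> v \<le> x" using iv by auto
        then have "(\<Sum>(u, v)\<in>S. H v - H u) \<le> H x - H a"
          using insert.IH[of x] pw \<open>a \<le> x\<close> by (simp add: pairwise_insert)
        then show "(\<Sum>(u, v)\<in>insert p S. H v - H u) \<le> H c - H a"
          using False \<open>finite S\<close> monoD[OF \<open>mono H\<close> \<open>y \<le> c\<close>] p by simp
      qed
    qed
  qed
  then show ?thesis using assms by auto
qed

text \<open>The exceptional sets below are never shown to be measurable, so their size is expressed
  through a measurable cover.\<close>

definition outer_measure_le :: "real set \<Rightarrow> real \<Rightarrow> bool" where
  "outer_measure_le A B \<longleftrightarrow> (\<exists>U\<in>lmeasurable. A \<subseteq> U \<and> measure lebesgue U \<le> B)"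

text \<open>On the line closed balls are closed intervals, so this is Vitali's covering theorem; the
  points to be covered need not be midpoints. Passing to open intervals loses only the endpoints,
  which are countably many.\<close>

lemma Vitali_intervals:
  fixes S :: "real set"
  assumes "open W" and "S \<subseteq> W"
    and fine: "\<And>x d. x \<in> S \<Longrightarrow> 0 < d \<Longrightarrow> \<exists>u v. u < v \<and> u \<le> x \<and> x \<le> v \<and> v - u < d \<and> P u v"
  obtains C where "countable C"
    "pairwise (\<lambda>(u, v) (u', v'). disjnt {u<..<v} {u'<..<v'}) C"
    "\<And>u v. (u, v) \<in> C \<Longrightarrow> u < v \<and> {u..v} \<subseteq> W \<and> P u v"
    "negligible (S - (\<Union>(u, v)\<in>C. {u<..<v}))"
proof -
  let ?K = "{(u, v). u < v \<and> {u..v} \<subseteq> W \<and> P u v}"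
  let ?a = "\<lambda>(u::real, v). (u + v) / 2" and ?r = "\<lambda>(u::real, v). (v - u) / 2"
  have cb: "cball (?a p) (?r p) = {fst p..snd p}" for p
    by (auto simp: cball_eq_atLeastAtMost field_simps split: prod.split)
  have r: "0 < ?r i" if "i \<in> ?K" for i using that by auto
  have ex: "\<exists>i. i \<in> ?K \<and> x \<in> cball (?a i) (?r i) \<and> ?r i < d" if "x \<in> S" "0 < d" for x d
  proof -
    obtain e where e: "e > 0" "ball x e \<subseteq> W"
      using \<open>open W\<close> \<open>S \<subseteq> W\<close> \<open>x \<in> S\<close> by (meson openE subsetD)
    obtain u v where uv: "u < v" "u \<le> x" "x \<le> v" "v - u < min d e" "P u v"
      using fine[OF \<open>x \<in> S\<close>, of "min d e"] e \<open>0 < d\<close> by auto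
    have "{u..v} \<subseteq> ball x e" using uv by (auto simp: dist_real_def)
    then have "(u, v) \<in> ?K" using uv e by auto
    moreover have "x \<in> cball (?a (u, v)) (?r (u, v))" unfolding cb using uv by simp
    moreover have "?r (u, v) < d" using uv by simp
    ultimately show ?thesis by blast
  qed
  obtain C where C: "countable C" "C \<subseteq> ?K"
    "pairwise (\<lambda>i j. disjnt (cball (?a i) (?r i)) (cball (?a j) (?r j))) C"
    "negligible (S - (\<Union>i\<in>C. cball (?a i) (?r i)))"
    using Vitali_covering_theorem_cballs[where K = ?K and a = ?a and r = ?r and S = S, OF r ex]
    by blast
  have eq: "S - (\<Union>(u, v)\<in>C. {u<..<v}) \<subseteq>
      (S - (\<Union>i\<in>C. cball (?a i) (?r i))) \<union> (fst ` C \<union> snd ` C)"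
    unfolding cb by force
  have "negligible (fst ` C \<union> snd ` C)"
    using \<open>countable C\<close> unfolding negligible_iff_null_sets
    by (intro null_sets_completionI countable_imp_null_set_lborel) auto
  then have "negligible (S - (\<Union>(u, v)\<in>C. {u<..<v}))"
    using negligible_subset[OF negligible_Un[OF C(4)] eq] by blast
  moreover have "pairwise (\<lambda>(u, v) (u', v'). disjnt {u<..<v} {u'<..<v'}) C"
    using C(3) unfolding cb
    by (rule pairwise_mono) (auto simp: disjnt_def)
  ultimately show ?thesis using that C by blast
qed

text \<open>\<open>G\<close> and \<open>H\<close> are two ways of measuring intervals. Small
  intervals on which \<open>G\<close> grows by no more than \<open>H\<close> cover almost all of the
  set. On each of them the \<open>G\<close>-bound applies, and the increments of the monotone
  \<open>H\<close> over disjoint intervals add up to at most \<open>H b - H a\<close>.\<close>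

lemma outer_measure_le_transfer:
  fixes G H :: "real \<Rightarrow> real"
  assumes "mono H"
    and G: "\<And>a b. a < b \<Longrightarrow> outer_measure_le (S \<inter> {a<..<b}) (G b - G a)"
    and fine: "\<And>x d. x \<in> S \<Longrightarrow> 0 < d \<Longrightarrow>
      \<exists>u v. u < v \<and> u \<le> x \<and> x \<le> v \<and> v - u < d \<and> G v - G u \<le> H v - H u"
    and "a < b"
  shows "outer_measure_le (S \<inter> {a<..<b}) (H b - H a)"
proof -
  let ?T = "S \<inter> {a<..<b}"
  obtain C where C: "countable C"
    "pairwise (\<lambda>(u, v) (u', v'). disjnt {u<..<v} {u'<..<v'}) C"
    "\<And>u v. (u, v) \<in> C \<Longrightarrow> u < v \<and> {u..v} \<subseteq> {a<..<b} \<and> G v - G u \<le> H v - H u"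
    "negligible (?T - (\<Union>(u, v)\<in>C. {u<..<v}))"
    using Vitali_intervals[of "{a<..<b}" ?T "\<lambda>u v. G v - G u \<le> H v - H u"] fine
    by (metis Int_iff Int_lower2 open_greaterThanLessThan)
  have "\<forall>p\<in>C. \<exists>U. U \<in> lmeasurable \<and> S \<inter> {fst p<..<snd p} \<subseteq> U \<and>
      measure lebesgue U \<le> G (snd p) - G (fst p)"
  proof
    fix p assume "p \<in> C"
    then have "outer_measure_le (S \<inter> {fst p<..<snd p}) (G (snd p) - G (fst p))"
      using C(3)[of "fst p" "snd p"] by (intro G) simp
    then show "\<exists>U. U \<in> lmeasurable \<and> S \<inter> {fst p<..<snd p} \<subseteq> U \<and>
        measure lebesgue U \<le> G (snd p) - G (fst p)"
      unfolding outer_measure_le_def by blast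
  qed
  then obtain U where U: "\<And>p. p \<in> C \<Longrightarrow> U p \<in> lmeasurable"
    "\<And>p. p \<in> C \<Longrightarrow> S \<inter> {fst p<..<snd p} \<subseteq> U p"
    "\<And>p. p \<in> C \<Longrightarrow> measure lebesgue (U p) \<le> G (snd p) - G (fst p)"
    by metis
  let ?V = "\<Union>p\<in>C. U p" and ?N = "?T - (\<Union>(u, v)\<in>C. {u<..<v})"
  \<comment> \<open>A bound valid for all finite subunions passes to the countable union.\<close>
  have bound: "measure lebesgue (\<Union>p\<in>D. U p) \<le> H b - H a" if "D \<subseteq> C" "finite D" for D
  proof -
    have "measure lebesgue (\<Union>p\<in>D. U p) \<le> (\<Sum>p\<in>D. measure lebesgue (U p))"
      using that U by (intro measure_UNION_le) (auto intro: fmeasurableD)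
    also have "\<dots> \<le> (\<Sum>(u, v)\<in>D. H v - H u)"
    proof (rule sum_mono)
      fix p assume "p \<in> D"
      then have "p \<in> C" using that by blast
      then show "measure lebesgue (U p) \<le> (case p of (u, v) \<Rightarrow> H v - H u)"
        using U(3)[of p] C(3)[of "fst p" "snd p"] by (simp add: case_prod_beta)
    qed
    also have "\<dots> \<le> H b - H a"
    proof (rule mono_sum_disjoint_intervals_le[OF \<open>mono H\<close> that(2)])
      show "pairwise (\<lambda>(u, v) (u', v'). disjnt {u<..<v} {u'<..<v'}) D"
        using C(2) that(1) by (rule pairwise_subset)
      show "u < v \<and> a \<le> u \<and> v \<le> b" if "(u, v) \<in> D" for u v
      proof -
        have uv: "u < v" "{u..v} \<subseteq> {a<..<b}" using C(3)[of u v] that \<open>D \<subseteq> C\<close> by blast+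
        then have "u \<in> {a<..<b}" "v \<in> {a<..<b}" by (auto simp del: greaterThanLessThan_iff)
        then show ?thesis using uv by simp
      qed
    qed (use \<open>a < b\<close> in simp)
    finally show ?thesis .
  qed
  have V: "?V \<in> lmeasurable" "measure lebesgue ?V \<le> H b - H a"
    using fmeasurable_UN_bound[OF C(1) U(1) bound] measure_UN_bound[OF C(1) U(1) bound] by blast+
  have N: "?N \<in> lmeasurable" "measure lebesgue ?N = 0"
    using C(4) by (auto simp: negligible_iff_measure)
  have "?V \<union> ?N \<in> lmeasurable" using V N by blast
  moreover have "measure lebesgue (?V \<union> ?N) \<le> H b - H a"
    using V N measure_Un_le[of ?V lebesgue ?N] by (simp add: fmeasurableD)
  moreover have "?T \<subseteq> ?V \<union> ?N" using U(2) by fastforce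
  ultimately show ?thesis unfolding outer_measure_le_def by blast
qed

section \<open>Lebesgue's differentiation theorem for monotone Lipschitz functions, then for
  curves\<close>

lemma negligible_two_slopes:
  fixes g :: "real \<Rightarrow> real"
  assumes "mono g" "0 < p" "p < q"
    and low: "\<And>x d. x \<in> S \<Longrightarrow> 0 < d \<Longrightarrow>
      \<exists>u v. u < v \<and> u \<le> x \<and> x \<le> v \<and> v - u < d \<and> g v - g u \<le> p * (v - u)"
    and high: "\<And>x d. x \<in> S \<Longrightarrow> 0 < d \<Longrightarrow>
      \<exists>u v. u < v \<and> u \<le> x \<and> x \<le> v \<and> v - u < d \<and> q * (v - u) \<le> g v - g u"
  shows "negligible S"
proof -
  \<comment> \<open>Each round covers \<open>S\<close> by flat intervals and, inside these, by steep ones;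
    this gains a factor \<open>p / q\<close>.\<close>
  have iter: "outer_measure_le (S \<inter> {a<..<b}) ((p / q) ^ n * b - (p / q) ^ n * a)" if "a < b" for a b n
    using that
  proof (induction n arbitrary: a b)
    case 0
    then show ?case unfolding outer_measure_le_def
      by (intro bexI[of _ "{a<..<b}"]) (auto simp: fmeasurableD)
  next
    case (Suc n)
    let ?k = "(p / q) ^ n"
    have k: "?k > 0" "q > 0" using assms by auto
    \<comment> \<open>Half a round: a steep interval has length at most 1/q times the increment of
      \<open>g\<close>, which turns the bound by length into one by increments of \<open>g\<close>.
      The flat intervals then convert back to length at the cost of a factor
      \<open>p\<close>.\<close>
    have 1: "outer_measure_le (S \<inter> {a<..<b}) (?k / q * g b - ?k / q * g a)" if "a < b" for a b
    proof (rule outer_measure_le_transfer[where G = "\<lambda>x. ?k * x", OF _ Suc.IH _ that])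
      show "mono (\<lambda>x. ?k / q * g x)"
        using k monoD[OF \<open>mono g\<close>] by (intro monoI mult_left_mono) auto
      fix x d :: real assume "x \<in> S" "0 < d"
      then obtain u v where uv: "u < v" "u \<le> x" "x \<le> v" "v - u < d" "q * (v - u) \<le> g v - g u"
        using high by blast
      then have "?k / q * (q * (v - u)) \<le> ?k / q * (g v - g u)"
        using k by (intro mult_left_mono) auto
      then have "?k * v - ?k * u \<le> ?k / q * g v - ?k / q * g u"
        using k by (simp add: right_diff_distrib)
      then show "\<exists>u v. u < v \<and> u \<le> x \<and> x \<le> v \<and> v - u < d \<and>
          ?k * v - ?k * u \<le> ?k / q * g v - ?k / q * g u"
        using uv by blast
    qed
    show ?case
    proof (rule outer_measure_le_transfer[where G = "\<lambda>x. ?k / q * g x", OF _ 1 _ \<open>a < b\<close>])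
      show "mono (\<lambda>x. (p / q) ^ Suc n * x)"
        using assms by (intro monoI mult_left_mono) auto
      fix x d :: real assume "x \<in> S" "0 < d"
      then obtain u v where uv: "u < v" "u \<le> x" "x \<le> v" "v - u < d" "g v - g u \<le> p * (v - u)"
        using low by blast
      then have "?k / q * (g v - g u) \<le> ?k / q * (p * (v - u))"
        using k by (intro mult_left_mono) auto
      then have "?k / q * g v - ?k / q * g u \<le> (p / q) ^ Suc n * v - (p / q) ^ Suc n * u"
        by (simp add: diff_divide_distrib algebra_simps)
      then show "\<exists>u v. u < v \<and> u \<le> x \<and> x \<le> v \<and> v - u < d \<and>
          ?k / q * g v - ?k / q * g u \<le> (p / q) ^ Suc n * v - (p / q) ^ Suc n * u"
        using uv by blast
    qed
  qed
  have neg: "negligible (S \<inter> {- real m<..<real m})" for m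
    unfolding negligible_outer_le
  proof (intro allI impI)
    fix e :: real assume "e > 0"
    show "\<exists>T. S \<inter> {- real m<..<real m} \<subseteq> T \<and> T \<in> lmeasurable \<and> measure lebesgue T \<le> e"
    proof (cases "m = 0")
      case True
      then show ?thesis using \<open>e > 0\<close> by (intro exI[of _ "{}"]) auto
    next
      case False
      have "(\<lambda>n. (p / q) ^ n * real m - (p / q) ^ n * (- real m)) \<longlonglongrightarrow> 0 * real m - 0 * (- real m)"
        using assms by (intro tendsto_intros LIMSEQ_power_zero) auto
      then have "eventually (\<lambda>n. (p / q) ^ n * real m - (p / q) ^ n * (- real m) < e) sequentially"
        using \<open>e > 0\<close> by (intro order_tendstoD) auto
      then obtain n where "(p / q) ^ n * real m - (p / q) ^ n * (- real m) < e"
        using eventually_happens trivial_limit_sequentially by blast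
      moreover have "outer_measure_le (S \<inter> {- real m<..<real m})
          ((p / q) ^ n * real m - (p / q) ^ n * (- real m))"
        using False by (intro iter) simp
      ultimately show ?thesis unfolding outer_measure_le_def by (meson less_imp_le order_trans)
    qed
  qed
  have "S = (\<Union>m. S \<inter> {- real m<..<real m})"
  proof -
    have "\<exists>m. x \<in> {- real m<..<real m}" for x
    proof -
      obtain m where "\<bar>x\<bar> < real m" using reals_Archimedean2 by blast
      then show ?thesis by (intro exI[of _ m]) auto
    qed
    then show ?thesis by blast
  qed
  moreover have "negligible (\<Union>m. S \<inter> {- real m<..<real m})"
    using neg by (intro negligible_countable_Union) auto
  ultimately show ?thesis by simp
qed

text \<open>The quotient is symmetric in its two points, so a point on either side of
  \<open>x\<close> gives an interval with \<open>x\<close> as an endpoint. One-sided derivatives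
  need no separate treatment.\<close>

lemma difference_quotient_interval:
  fixes g :: "real \<Rightarrow> real"
  assumes fr: "frequently (\<lambda>y. P ((g y - g x) / (y - x))) (at x)" and "0 < d"
  shows "\<exists>u v. u < v \<and> u \<le> x \<and> x \<le> v \<and> v - u < d \<and> P ((g v - g u) / (v - u))"
proof -
  obtain y where y: "y \<noteq> x" "dist y x < d" "P ((g y - g x) / (y - x))"
    using fr \<open>0 < d\<close> unfolding frequently_def eventually_at by auto
  have sym: "(g y - g x) / (y - x) = (g x - g y) / (x - y)"
    by (metis minus_diff_eq minus_divide_divide)
  show ?thesis
  proof (cases "y < x")
    case True
    then show ?thesis using y sym by (intro exI[of _ y] exI[of _ x]) (auto simp: dist_real_def)
  next
    case False
    then show ?thesis using y by (intro exI[of _ x] exI[of _ y]) (auto simp: dist_real_def)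
  qed
qed

text \<open>Difference quotients lie in [0, L], so without a derivative their lower and upper limits
  differ, and two rationals fit in the gap. The points belonging to a given pair of rationals form a
  negligible set, and there are countably many pairs.\<close>

lemma negligible_non_differentiable_mono_lipschitz:
  fixes g :: "real \<Rightarrow> real"
  assumes "mono g" and lip: "L-lipschitz_on UNIV g"
  shows "negligible {x. \<not> g differentiable at x}"
proof -
  let ?Q = "\<lambda>x y. (g y - g x) / (y - x)"
  define S where "S p q = {x. frequently (\<lambda>y. ?Q x y < p) (at x) \<and>
    frequently (\<lambda>y. q < ?Q x y) (at x)}" for p q
  have neg: "negligible (S p q)" if "0 < p" "p < q" for p q
  proof (rule negligible_two_slopes[OF \<open>mono g\<close> that])
    fix x d :: real assume "x \<in> S p q" "0 < d"
    have "\<exists>u v. u < v \<and> u \<le> x \<and> x \<le> v \<and> v - u < d \<and> (g v - g u) / (v - u) < p"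
      using \<open>x \<in> S p q\<close> \<open>0 < d\<close> unfolding S_def
      by (intro difference_quotient_interval) auto
    then show "\<exists>u v. u < v \<and> u \<le> x \<and> x \<le> v \<and> v - u < d \<and> g v - g u \<le> p * (v - u)"
      by (force simp: divide_less_eq)
    have "\<exists>u v. u < v \<and> u \<le> x \<and> x \<le> v \<and> v - u < d \<and> q < (g v - g u) / (v - u)"
      using \<open>x \<in> S p q\<close> \<open>0 < d\<close> unfolding S_def
      by (intro difference_quotient_interval) auto
    then show "\<exists>u v. u < v \<and> u \<le> x \<and> x \<le> v \<and> v - u < d \<and> q * (v - u) \<le> g v - g u"
      by (force simp: less_divide_eq)
  qed
  have bd: "0 \<le> ?Q x y \<and> ?Q x y \<le> L" if "y \<noteq> x" for x y
  proof -
    have "\<bar>g y - g x\<bar> \<le> L * \<bar>y - x\<bar>"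
      using lipschitz_onD[OF lip, of y x] by (simp add: dist_real_def)
    then have "\<bar>?Q x y\<bar> \<le> L"
      using that by (simp add: abs_divide divide_le_eq)
    moreover have "0 \<le> ?Q x y"
      using monoD[OF \<open>mono g\<close>] by (cases "y \<le> x") (auto intro: divide_nonneg_nonneg divide_nonpos_nonpos)
    ultimately show ?thesis by (metis abs_le_D1)
  qed
  have sub: "{x. \<not> g differentiable at x} \<subseteq> (\<Union>p\<in>\<rat>. \<Union>q\<in>\<rat>. if 0 < p \<and> p < q then S p q else {})"
  proof
    fix x assume "x \<in> {x. \<not> g differentiable at x}"
    then have nd: "\<not> g differentiable at x" by simp
    let ?f = "\<lambda>y. ereal (?Q x y)"
    let ?l = "Liminf (at x) ?f" and ?L = "Limsup (at x) ?f"
    have "0 \<le> ?l" by (rule Liminf_bounded) (auto simp: eventually_at bd intro!: exI[of _ 1])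
    have "?L \<le> ereal L" by (rule Limsup_bounded) (auto simp: eventually_at bd intro!: exI[of _ 1])
    have "?l \<le> ?L" by (rule Liminf_le_Limsup) simp
    have "?l \<noteq> ?L"
    proof
      assume eq: "?l = ?L"
      then obtain r where r: "?L = ereal r"
        using \<open>0 \<le> ?l\<close> \<open>?L \<le> ereal L\<close> by (cases ?L) auto
      then have "(?f \<longlongrightarrow> ereal r) (at x)"
        using eq r by (subst tendsto_iff_Liminf_eq_Limsup) auto
      then have "(?Q x \<longlongrightarrow> r) (at x)" by (simp only: lim_ereal)
      then have "(g has_field_derivative r) (at x)" by (simp add: has_field_derivative_iff)
      then show False using nd real_differentiable_def by blast
    qed
    then have "?l < ?L" using \<open>?l \<le> ?L\<close> by simp
    then obtain p0 where p0: "?l < ereal p0" "ereal p0 < ?L" by (meson ereal_dense2)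
    then obtain q0 where q0: "ereal p0 < ereal q0" "ereal q0 < ?L" by (meson ereal_dense2)
    \<comment> \<open>Reals \<open>p1 < p0 < q0\<close> strictly inside the gap leave room for
      rationals \<open>p\<close> between \<open>p1\<close> and \<open>p0\<close>, and
      \<open>q\<close> between \<open>p0\<close> and \<open>q0\<close>.\<close>
    obtain p1 where p1: "?l < ereal p1" "ereal p1 < ereal p0" using ereal_dense2[OF p0(1)] by blast
    obtain p where p: "p \<in> \<rat>" "p1 < p" "p < p0" using Rats_dense_in_real[of p1 p0] p1 by auto
    obtain q where q: "q \<in> \<rat>" "p0 < q" "q < q0" using Rats_dense_in_real[of p0 q0] q0 by auto
    have "?l < ereal p" using p p1(1) by (meson less_ereal.simps(1) less_trans)
    then have fp: "frequently (\<lambda>y. ?Q x y < p) (at x)"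
      using Liminf_bounded[of "ereal p" ?f "at x"]
      by (auto simp: frequently_def not_less)
    have "ereal q < ?L" using q q0(2) by (meson less_ereal.simps(1) less_trans)
    then have fq: "frequently (\<lambda>y. q < ?Q x y) (at x)"
      using Limsup_bounded[of ?f "ereal q" "at x"]
      by (auto simp: frequently_def not_less)
    have "0 < p" using \<open>0 \<le> ?l\<close> \<open>?l < ereal p\<close>
      by (metis ereal_less(2) order_le_less_trans)
    then show "x \<in> (\<Union>p\<in>\<rat>. \<Union>q\<in>\<rat>. if 0 < p \<and> p < q then S p q else {})"
      using p q fp fq by (intro UN_I[of p] UN_I[of q]) (auto simp: S_def)
  qed
  have "negligible (\<Union>p\<in>\<rat>. \<Union>q\<in>\<rat>. if 0 < p \<and> p < q then S p q else {})"
  proof -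
    have "negligible (\<Union>q\<in>\<rat>. if 0 < p \<and> p < q then S p q else {})" for p
      using countable_rat by (intro negligible_countable_Union) (auto simp: neg)
    then show ?thesis
      using countable_rat by (intro negligible_countable_Union) auto
  qed
  then show ?thesis using sub negligible_subset by blast
qed

text \<open>Adding \<open>L * t\<close> to a component makes it monotone, with Lipschitz constant
  \<open>L + L\<close>, and does not affect its differentiability.\<close>

lemma negligible_non_differentiable_lipschitz:
  fixes x :: "real \<Rightarrow> 'a::euclidean_space"
  assumes lip: "L-lipschitz_on UNIV x"
  shows "negligible {t. \<not> x differentiable at t}"
proof -
  have L: "L \<ge> 0" using lip lipschitz_on_nonneg by blast
  have "negligible {t. \<not> (\<lambda>t. x t \<bullet> b) differentiable at t}" if "b \<in> Basis" for b
  proof -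
    let ?g = "\<lambda>t. x t \<bullet> b + L * t"
    have bd: "\<bar>x t \<bullet> b - x s \<bullet> b\<bar> \<le> L * \<bar>t - s\<bar>" for s t
      using lipschitz_onD[OF lip, of t s] Basis_le_norm[OF that, of "x t - x s"]
      by (simp add: dist_norm inner_diff_left)
    have "mono ?g"
    proof (rule monoI)
      fix s t :: real assume "s \<le> t"
      then show "?g s \<le> ?g t" using bd[of t s] by (simp add: algebra_simps abs_le_iff)
    qed
    moreover have "(L + L)-lipschitz_on UNIV ?g"
    proof (rule lipschitz_onI)
      fix s t :: real
      have "\<bar>?g s - ?g t\<bar> \<le> \<bar>x s \<bullet> b - x t \<bullet> b\<bar> + \<bar>L * (s - t)\<bar>" by (simp add: algebra_simps)
      also have "\<dots> \<le> L * \<bar>s - t\<bar> + L * \<bar>s - t\<bar>" using bd[of s t] L by (simp add: abs_mult)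
      finally show "dist (?g s) (?g t) \<le> (L + L) * dist s t"
        by (simp add: dist_real_def algebra_simps)
    qed (use L in auto)
    ultimately have "negligible {t. \<not> ?g differentiable at t}"
      by (rule negligible_non_differentiable_mono_lipschitz)
    moreover have "(\<lambda>t. x t \<bullet> b) differentiable at t" if "?g differentiable at t" for t
    proof -
      have "(\<lambda>t. ?g t - L * t) differentiable at t"
        by (intro differentiable_diff that differentiable_mult differentiable_const differentiable_ident)
      then show ?thesis by simp
    qed
    ultimately show ?thesis by (auto elim: negligible_subset)
  qed
  then have "negligible (\<Union>b\<in>Basis. {t. \<not> (\<lambda>t. x t \<bullet> b) differentiable at t})"
    by (intro negligible_Union) auto
  moreover have "{t. \<not> x differentiable at t} \<subseteq>
      (\<Union>b\<in>Basis. {t. \<not> (\<lambda>t. x t \<bullet> b) differentiable at t})"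
    using differentiable_componentwise_within[of x _ UNIV] by auto
  ultimately show ?thesis using negligible_subset by blast
qed

subsection \<open>Clarke subdifferentials\<close>

lemma clarke_dir_deriv_lessD:
  assumes "clarke_dir_deriv g x d < ereal c"
  shows "\<exists>P Q. eventually P (nhds x) \<and> eventually Q (at_right 0) \<and>
    (\<forall>y t. P y \<longrightarrow> Q t \<longrightarrow> (g (y + t *\<^sub>R d) - g y) / t < c)"
proof -
  have "\<forall>\<^sub>F p in nhds x \<times>\<^sub>F at_right 0.
      (case p of (y, t) \<Rightarrow> ereal ((g (y + t *\<^sub>R d) - g y) / t)) < ereal c"
    by (rule Limsup_lessD[OF assms[unfolded clarke_dir_deriv_def]])
  then show ?thesis unfolding eventually_prod_filter by simp
qed

lemma clarke_dir_deriv_le: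
  assumes "eventually P (nhds x)" "eventually Q (at_right 0)"
    "\<And>y t. P y \<Longrightarrow> Q t \<Longrightarrow> (g (y + t *\<^sub>R d) - g y) / t \<le> c"
  shows "clarke_dir_deriv g x d \<le> ereal c"
  unfolding clarke_dir_deriv_def
proof (rule Limsup_bounded)
  show "\<forall>\<^sub>F p in nhds x \<times>\<^sub>F at_right 0.
      (case p of (y, t) \<Rightarrow> ereal ((g (y + t *\<^sub>R d) - g y) / t)) \<le> ereal c"
    unfolding eventually_prod_filter using assms by (intro exI[of _ P] exI[of _ Q]) auto
qed

text \<open>A neighbourhood of \<open>x\<close> is also a neighbourhood of every point near
  \<open>x\<close>, so the same bound on difference quotients serves for all of these
  points.\<close>

lemma clarke_dir_deriv_upper_semicontinuous:
  assumes "clarke_dir_deriv g x d < ereal c"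
  shows "\<forall>\<^sub>F y in nhds x. clarke_dir_deriv g y d \<le> ereal c"
proof -
  obtain P Q where P: "eventually P (nhds x)" and Q: "eventually Q (at_right 0)"
    and PQ: "\<And>y t. P y \<Longrightarrow> Q t \<Longrightarrow> (g (y + t *\<^sub>R d) - g y) / t < c"
    using clarke_dir_deriv_lessD[OF assms] by blast
  have "\<forall>\<^sub>F y in nhds x. eventually P (nhds y)"
    using P by (simp add: eventually_eventually)
  then show ?thesis
  proof eventually_elim
    case (elim y)
    show ?case by (rule clarke_dir_deriv_le[OF elim Q]) (auto dest: PQ)
  qed
qed

text \<open>Takes the place of a closed graph of the subdifferential, one direction at a time: the
  bound holds for all subgradients at all nearby points.\<close>

lemma clarke_subdiff_inner_le_near:
  assumes "clarke_dir_deriv g x d = ereal l" "0 < \<eta>"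
  shows "\<exists>\<rho>>0. \<forall>y\<in>ball x \<rho>. \<forall>s\<in>clarke_subdiff g y. s \<bullet> d \<le> l + \<eta>"
proof -
  have "\<forall>\<^sub>F y in nhds x. clarke_dir_deriv g y d \<le> ereal (l + \<eta>)"
    using assms by (intro clarke_dir_deriv_upper_semicontinuous) simp
  then obtain \<rho> where "\<rho> > 0" "\<And>y. dist y x < \<rho> \<Longrightarrow> clarke_dir_deriv g y d \<le> ereal (l + \<eta>)"
    unfolding eventually_nhds_metric by blast
  moreover have "s \<bullet> d \<le> l + \<eta>"
    if "s \<in> clarke_subdiff g y" "clarke_dir_deriv g y d \<le> ereal (l + \<eta>)" for s y
  proof -
    have "ereal (s \<bullet> d) \<le> clarke_dir_deriv g y d" using that(1) by (simp add: clarke_subdiff_def)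
    also note that(2)
    finally show ?thesis by simp
  qed
  ultimately show ?thesis by (metis dist_commute mem_ball)
qed

text \<open>Testing the subgradient in its own direction gives |s|^2 \<le> L |s|. The radius is
  halved so that both \<open>y\<close> and \<open>y + t *\<^sub>R s\<close> stay in the ball where
  the Lipschitz bound holds.\<close>

lemma norm_clarke_subdiff_le:
  assumes lip: "L-lipschitz_on (ball x r) g" and "0 < r" and s: "s \<in> clarke_subdiff g x"
  shows "norm s \<le> L"
proof -
  have L: "0 \<le> L" using lip lipschitz_on_nonneg by blast
  have "eventually (\<lambda>y. y \<in> ball x (r / 2)) (nhds x)"
    using \<open>0 < r\<close> by (intro eventually_nhds_in_open) auto
  moreover have "eventually (\<lambda>t. 0 < t \<and> t * norm s < r / 2) (at_right 0)"
  proof (intro eventually_conj eventually_at_right_less)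
    have "((\<lambda>t. t * norm s) \<longlongrightarrow> 0 * norm s) (at_right 0)" by (intro tendsto_intros)
    then show "eventually (\<lambda>t. t * norm s < r / 2) (at_right 0)"
      using \<open>0 < r\<close> by (intro order_tendstoD(2)) auto
  qed
  moreover have "(g (y + t *\<^sub>R s) - g y) / t \<le> L * norm s"
    if "y \<in> ball x (r / 2)" "0 < t \<and> t * norm s < r / 2" for y t
  proof -
    have "dist x (y + t *\<^sub>R s) \<le> dist x y + norm (t *\<^sub>R s)"
      by (metis add.commute dist_commute dist_norm dist_triangle add_diff_cancel_left')
    then have "y + t *\<^sub>R s \<in> ball x r" using that by auto
    moreover have "y \<in> ball x r" using that(1) \<open>0 < r\<close> by (auto elim: subsetD[rotated])
    ultimately have "\<bar>g (y + t *\<^sub>R s) - g y\<bar> \<le> L * norm (t *\<^sub>R s)"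
      using lipschitz_onD[OF lip, of "y + t *\<^sub>R s" y] by (simp add: dist_norm)
    then have "g (y + t *\<^sub>R s) - g y \<le> L * (t * norm s)" using that by simp
    then show ?thesis using that by (simp add: divide_le_eq mult_ac)
  qed
  ultimately have "clarke_dir_deriv g x s \<le> ereal (L * norm s)"
    by (rule clarke_dir_deriv_le)
  moreover have "ereal (s \<bullet> s) \<le> clarke_dir_deriv g x s"
    using s by (simp add: clarke_subdiff_def)
  ultimately have "ereal (s \<bullet> s) \<le> ereal (L * norm s)" by (rule order_trans[rotated])
  then have "norm s * norm s \<le> L * norm s"
    by (simp add: power2_norm_eq_inner power2_eq_square[symmetric])
  then show ?thesis using L by (cases "s = 0") auto
qed

lemma bounded_clarke_subdiff_compact:
  assumes "locally_lipschitz g" "compact K"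
  shows "\<exists>L. \<forall>y\<in>K. \<forall>s\<in>clarke_subdiff g y. norm s \<le> L"
proof -
  have "\<forall>x. \<exists>r L. r > 0 \<and> L-lipschitz_on (ball x r) g"
    using assms(1) unfolding locally_lipschitz_def by blast
  then obtain r L where rL: "\<And>x. r x > 0" "\<And>x. (L x)-lipschitz_on (ball x (r x)) g" by metis
  obtain D where D: "D \<subseteq> K" "finite D" "K \<subseteq> (\<Union>x\<in>D. ball x (r x))"
  proof (rule compactE_image[OF \<open>compact K\<close>, of K "\<lambda>x. ball x (r x)"])
    show "K \<subseteq> (\<Union>x\<in>K. ball x (r x))" using rL(1) by auto
  qed auto
  \<comment> \<open>A sum of absolute values in place of a maximum, so that an empty
    \<open>D\<close> needs no special case.\<close>
  have "norm s \<le> (\<Sum>x\<in>D. \<bar>L x\<bar>)" if y: "y \<in> K" and s: "s \<in> clarke_subdiff g y" for y s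
  proof -
    obtain x where x: "x \<in> D" "y \<in> ball x (r x)" using D(3) y by blast
    then obtain e where e: "e > 0" "ball y e \<subseteq> ball x (r x)" by (meson open_ball openE)
    have "norm s \<le> L x"
      using norm_clarke_subdiff_le[OF lipschitz_on_subset[OF rL(2) e(2)] e(1) s] .
    also have "\<dots> \<le> (\<Sum>x\<in>D. \<bar>L x\<bar>)"
      using member_le_sum[OF x(1), of "\<lambda>x. \<bar>L x\<bar>"] D(2) by simp
    finally show ?thesis .
  qed
  then show ?thesis by blast
qed

lemma bounded_clarke_subdiff_family:
  assumes "finite I" "\<And>i. i \<in> I \<Longrightarrow> locally_lipschitz (F i)" "compact K"
  shows "\<exists>L\<ge>0. \<forall>i\<in>I. \<forall>y\<in>K. \<forall>s\<in>clarke_subdiff (F i) y. norm s \<le> L"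
proof -
  have "\<forall>i\<in>I. \<exists>L. \<forall>y\<in>K. \<forall>s\<in>clarke_subdiff (F i) y. norm s \<le> L"
    using bounded_clarke_subdiff_compact assms by blast
  then obtain L where L: "\<forall>i\<in>I. \<forall>y\<in>K. \<forall>s\<in>clarke_subdiff (F i) y. norm s \<le> L i"
    by metis
  have "L i \<le> (\<Sum>i\<in>I. \<bar>L i\<bar>)" if "i \<in> I" for i
    using member_le_sum[OF that, of "\<lambda>i. \<bar>L i\<bar>"] \<open>finite I\<close> by simp
  then have "\<forall>i\<in>I. \<forall>y\<in>K. \<forall>s\<in>clarke_subdiff (F i) y. norm s \<le> (\<Sum>i\<in>I. \<bar>L i\<bar>)"
    using L order_trans by blast
  then show ?thesis using sum_nonneg[of I "\<lambda>i. \<bar>L i\<bar>"] by (intro exI[of _ "\<Sum>i\<in>I. \<bar>L i\<bar>"]) simp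
qed

section \<open>Directional derivatives of an average of regular functions\<close>

lemma tendsto_le_clarke_dir_deriv:
  assumes "((\<lambda>t. (g (x + t *\<^sub>R d) - g x) / t) \<longlongrightarrow> l) (at_right 0)"
  shows "ereal l \<le> clarke_dir_deriv g x d"
proof -
  have "l \<le> c" if less: "clarke_dir_deriv g x d < ereal c" for c
  proof -
    obtain P Q where "eventually P (nhds x)" "eventually Q (at_right 0)"
      and PQ: "\<And>y t. P y \<Longrightarrow> Q t \<Longrightarrow> (g (y + t *\<^sub>R d) - g y) / t < c"
      using clarke_dir_deriv_lessD[OF less] by blast
    then have "P x" "eventually Q (at_right 0)"
      using eventually_nhds_x_imp_x[of P x] by auto
    then have "\<forall>\<^sub>F t in at_right 0. (g (x + t *\<^sub>R d) - g x) / t \<le> c"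
      using PQ less_imp_le by (blast intro: eventually_mono)
    then show ?thesis by (rule tendsto_upperbound[OF assms]) simp
  qed
  then show ?thesis
  proof (intro leI notI)
    assume *: "\<And>c. clarke_dir_deriv g x d < ereal c \<Longrightarrow> l \<le> c"
    assume "clarke_dir_deriv g x d < ereal l"
    then obtain c where "clarke_dir_deriv g x d < ereal c" "ereal c < ereal l"
      using ereal_dense2 by blast
    then show False using *[of c] by simp
  qed
qed

text \<open>By regularity each \<open>l i\<close> is a genuine one-sided derivative. Such limits add
  up, so the left side is the one-sided derivative of the average, which never exceeds its Clarke
  derivative.\<close>

lemma clarke_dir_deriv_average_ge:
  assumes reg: "\<And>i. i \<in> I \<Longrightarrow> subdifferentially_regular (F i)"
    and l: "\<And>i. i \<in> I \<Longrightarrow> clarke_dir_deriv (F i) x d = ereal (l i)"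
  shows "ereal ((\<Sum>i\<in>I. l i) / c) \<le> clarke_dir_deriv (\<lambda>x. (\<Sum>i\<in>I. F i x) / c) x d"
proof (rule tendsto_le_clarke_dir_deriv)
  have "((\<lambda>t. (F i (x + t *\<^sub>R d) - F i x) / t) \<longlongrightarrow> l i) (at_right 0)" if i: "i \<in> I" for i
  proof -
    obtain l' where "((\<lambda>t. (F i (x + t *\<^sub>R d) - F i x) / t) \<longlongrightarrow> l') (at_right 0)"
      "clarke_dir_deriv (F i) x d = ereal l'"
      using reg[OF i] unfolding subdifferentially_regular_def by blast
    then show ?thesis using l[OF i] by simp
  qed
  then have "((\<lambda>t. (\<Sum>i\<in>I. (F i (x + t *\<^sub>R d) - F i x) / t) / c) \<longlongrightarrow> (\<Sum>i\<in>I. l i) / c) (at_right 0)"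
    unfolding divide_inverse[of _ c] by (intro tendsto_mult tendsto_sum tendsto_const)
  moreover have "(\<Sum>i\<in>I. (F i (x + t *\<^sub>R d) - F i x) / t) / c =
      ((\<Sum>i\<in>I. F i (x + t *\<^sub>R d)) / c - (\<Sum>i\<in>I. F i x) / c) / t" for t
    by (simp add: sum_divide_distrib[symmetric] sum_subtractf diff_divide_distrib[symmetric] mult.commute)
  ultimately show "((\<lambda>t. ((\<Sum>i\<in>I. F i (x + t *\<^sub>R d)) / c - (\<Sum>i\<in>I. F i x) / c) / t)
      \<longlongrightarrow> (\<Sum>i\<in>I. l i) / c) (at_right 0)"
    by simp
qed

subsection \<open>A priori bounds for random reshuffling with momentum\<close>

text \<open>The inner index is shifted by one to be natural: \<open>w k j\<close> is x_{k,j-1}, thus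
  \<open>w k 0\<close> is the last but one point of the previous epoch and \<open>w k 1\<close> is
  x_k. The subgradient \<open>s k j\<close> is the one that produces x_{k,j+1}.\<close>

locale rrm_run =
  fixes F :: "nat \<Rightarrow> 'a::euclidean_space \<Rightarrow> real" and N :: nat and \<beta> \<gamma> \<alpha> :: real
    and x :: "nat \<Rightarrow> 'a" and w s :: "nat \<Rightarrow> nat \<Rightarrow> 'a" and \<sigma> :: "nat \<Rightarrow> nat \<Rightarrow> nat"
  assumes \<alpha>_pos: "0 < \<alpha>"
    and w_1: "w k (Suc 0) = x k"
    and w_last: "w k (Suc N) = x (Suc k)"
    and w_Suc_0: "w (Suc k) 0 = w k N"
    and \<sigma>: "\<sigma> k permutes {1..N}"
    and subgrad: "j < N \<Longrightarrow>
      s k j \<in> clarke_subdiff (F (\<sigma> k (Suc j))) (w k (Suc j) + \<gamma> *\<^sub>R (w k (Suc j) - w k j))"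
    and step: "j < N \<Longrightarrow>
      w k (Suc (Suc j)) = w k (Suc j) + \<beta> *\<^sub>R (w k (Suc j) - w k j) - \<alpha> *\<^sub>R s k j"
begin

definition vel :: "nat \<Rightarrow> 'a" where
  "vel k = w k (Suc 0) - w k 0"

lemma epoch_increment:
  "(1 - \<beta>) *\<^sub>R (x (Suc k) - x k) = \<beta> *\<^sub>R (vel k - vel (Suc k)) - \<alpha> *\<^sub>R (\<Sum>j<N. s k j)"
proof -
  have "(\<Sum>j<N. w k (Suc (Suc j)) - w k (Suc j)) =
      (\<Sum>j<N. \<beta> *\<^sub>R (w k (Suc j) - w k j) - \<alpha> *\<^sub>R s k j)"
    using step by (intro sum.cong) auto
  also have "\<dots> = \<beta> *\<^sub>R (\<Sum>j<N. w k (Suc j) - w k j) - \<alpha> *\<^sub>R (\<Sum>j<N. s k j)"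
    by (subst sum_subtractf) (simp only: scaleR_sum_right)
  finally have "x (Suc k) - x k = \<beta> *\<^sub>R (w k N - w k 0) - \<alpha> *\<^sub>R (\<Sum>j<N. s k j)"
    using sum_lessThan_telescope[of "\<lambda>j. w k (Suc j)" N] sum_lessThan_telescope[of "w k" N]
    by (simp add: w_1 w_last)
  \<comment> \<open>The momentum differences lag one inner step behind. As \<open>w k N\<close> is
    the last but one point of the epoch, their sum is the epoch increment corrected by the
    velocities at its two ends; moving \<beta> times this increment to the left produces the factor
    1 - \<beta>.\<close>
  moreover have "w k N - w k 0 = (vel k - vel (Suc k)) + (x (Suc k) - x k)"
    by (simp add: vel_def w_1 w_Suc_0)
  ultimately have "x (Suc k) - x k =
      \<beta> *\<^sub>R ((vel k - vel (Suc k)) + (x (Suc k) - x k)) - \<alpha> *\<^sub>R (\<Sum>j<N. s k j)" by simp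
  then show ?thesis by (simp add: scaleR_left_diff_distrib scaleR_right_distrib algebra_simps)
qed

lemma increment:
  assumes "a \<le> b"
  shows "(1 - \<beta>) *\<^sub>R (x b - x a) = \<beta> *\<^sub>R (vel a - vel b) - \<alpha> *\<^sub>R (\<Sum>k=a..<b. \<Sum>j<N. s k j)"
proof -
  have "(1 - \<beta>) *\<^sub>R (x b - x a) = (\<Sum>k=a..<b. (1 - \<beta>) *\<^sub>R (x (Suc k) - x k))"
    by (simp only: scaleR_sum_right[symmetric] sum_Suc_diff'[OF assms])
  also have "\<dots> = \<beta> *\<^sub>R (\<Sum>k=a..<b. vel k - vel (Suc k)) - \<alpha> *\<^sub>R (\<Sum>k=a..<b. \<Sum>j<N. s k j)"
    unfolding epoch_increment by (subst sum_subtractf) (simp only: scaleR_sum_right)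
  also have "(\<Sum>k=a..<b. vel k - vel (Suc k)) = vel a - vel b"
    using sum_Suc_diff'[OF assms, of vel] sum_negf[of "\<lambda>k. vel (Suc k) - vel k" "{a..<b}"] by simp
  finally show ?thesis .
qed

text \<open>The bounds \<open>l i\<close> depend on the component but not on the epoch, and an epoch
  uses each component exactly once. So each epoch contributes the same bound whatever its
  permutation, and only the two end velocities are left, each at most
  \<open>C * \<alpha>\<close>.\<close>

lemma increment_inner_le:
  assumes "a \<le> b" "\<beta> \<in> {-1<..<1}" "norm (vel a) \<le> C * \<alpha>" "norm (vel b) \<le> C * \<alpha>"
    and sub: "\<And>k j. a \<le> k \<Longrightarrow> k < b \<Longrightarrow> j < N \<Longrightarrow> s k j \<bullet> d \<le> l (\<sigma> k (Suc j)) + \<eta>"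
  shows "- ((1 - \<beta>) * ((x b - x a) \<bullet> d)) \<le>
    2 * C * norm d * \<alpha> + real (b - a) * \<alpha> * ((\<Sum>i=1..N. l i) + real N * \<eta>)"
proof -
  have "(\<Sum>j<N. s k j) \<bullet> d \<le> (\<Sum>i=1..N. l i) + real N * \<eta>" if "a \<le> k" "k < b" for k
  proof -
    have "(\<Sum>j<N. s k j) \<bullet> d = (\<Sum>j<N. s k j \<bullet> d)" by (simp add: inner_sum_left)
    also have "\<dots> \<le> (\<Sum>j<N. l (\<sigma> k (Suc j)) + \<eta>)" using sub that by (intro sum_mono) auto
    also have "\<dots> = (\<Sum>j<N. l (\<sigma> k (Suc j))) + real N * \<eta>" by (simp add: sum.distrib)
    also have "(\<Sum>j<N. l (\<sigma> k (Suc j))) = (\<Sum>i=1..N. l (\<sigma> k i))"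
      by (rule sum.reindex_bij_witness[of _ "\<lambda>i. i - 1" Suc]) auto
    also have "\<dots> = (\<Sum>i=1..N. l i)" using sum.permute[OF \<sigma>[of k], of l] by (simp add: o_def)
    finally show ?thesis .
  qed
  then have "(\<Sum>k=a..<b. (\<Sum>j<N. s k j) \<bullet> d) \<le> (\<Sum>k=a..<b. (\<Sum>i=1..N. l i) + real N * \<eta>)"
    by (intro sum_mono) auto
  then have "(\<Sum>k=a..<b. \<Sum>j<N. s k j) \<bullet> d \<le> real (b - a) * ((\<Sum>i=1..N. l i) + real N * \<eta>)"
    by (simp add: inner_sum_left)
  then have S: "\<alpha> * ((\<Sum>k=a..<b. \<Sum>j<N. s k j) \<bullet> d) \<le>
      \<alpha> * (real (b - a) * ((\<Sum>i=1..N. l i) + real N * \<eta>))"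
    using \<alpha>_pos by (intro mult_left_mono) auto
  have "- (\<beta> * ((vel a - vel b) \<bullet> d)) \<le> \<bar>\<beta>\<bar> * \<bar>(vel a - vel b) \<bullet> d\<bar>"
    by (metis abs_ge_minus_self abs_mult)
  also have "\<dots> \<le> 1 * (norm (vel a - vel b) * norm d)"
    using assms(2) by (intro mult_mono Cauchy_Schwarz_ineq2) auto
  also have "\<dots> \<le> 2 * (C * \<alpha>) * norm d"
    using assms(3,4) norm_triangle_ineq4[of "vel a" "vel b"]
    by (simp only: mult_1) (intro mult_right_mono, auto)
  finally have V: "- (\<beta> * ((vel a - vel b) \<bullet> d)) \<le> 2 * (C * \<alpha>) * norm d" .
  have "(1 - \<beta>) * ((x b - x a) \<bullet> d) = ((1 - \<beta>) *\<^sub>R (x b - x a)) \<bullet> d" by simp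
  also have "\<dots> = \<beta> * ((vel a - vel b) \<bullet> d) - \<alpha> * ((\<Sum>k=a..<b. \<Sum>j<N. s k j) \<bullet> d)"
    unfolding increment[OF \<open>a \<le> b\<close>] by (simp only: inner_diff_left inner_scaleR_left)
  finally show ?thesis using S V by (simp add: mult_ac)
qed

section \<open>Bounds that keep the iterates in a fixed ball\<close>

context
  fixes C L R :: real
  assumes C: "0 \<le> C" "\<bar>\<beta>\<bar> * C + L \<le> C" "(real N + \<bar>\<gamma>\<bar>) * C * \<alpha> \<le> 1"
    and L: "\<forall>i\<in>{1..N}. \<forall>y\<in>cball 0 (R + 2). \<forall>s\<in>clarke_subdiff (F i) y. norm s \<le> L"
begin

lemma norm_inner_point_le:
  assumes "j < N" "norm (w k (Suc j) - w k j) \<le> C * \<alpha>" "norm (w k (Suc j) - x k) \<le> real j * C * \<alpha>"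
  shows "norm (w k (Suc j) + \<gamma> *\<^sub>R (w k (Suc j) - w k j) - x k) \<le> (real N + \<bar>\<gamma>\<bar>) * C * \<alpha>"
proof -
  have "norm (w k (Suc j) + \<gamma> *\<^sub>R (w k (Suc j) - w k j) - x k)
      \<le> norm (w k (Suc j) - x k) + norm (\<gamma> *\<^sub>R (w k (Suc j) - w k j))"
    using norm_triangle_ineq[of "w k (Suc j) - x k" "\<gamma> *\<^sub>R (w k (Suc j) - w k j)"]
    by (simp add: algebra_simps)
  also have "\<dots> \<le> real j * (C * \<alpha>) + \<bar>\<gamma>\<bar> * (C * \<alpha>)"
    using assms mult_left_mono[OF assms(2), of "\<bar>\<gamma>\<bar>"] by (intro add_mono) (simp_all add: mult_ac)
  also have "\<dots> \<le> real N * (C * \<alpha>) + \<bar>\<gamma>\<bar> * (C * \<alpha>)"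
    using assms(1) C(1) \<alpha>_pos by (intro add_right_mono mult_right_mono) auto
  finally show ?thesis by (simp add: algebra_simps)
qed

text \<open>A step of length at most C \<alpha> is followed by one of length at most |\<beta>| C
  \<alpha> + L \<alpha> \<le> C \<alpha>, provided that the subgradient is bounded by
  \<open>L\<close>. It is: x_k lies within R + 1 and the evaluation point within distance 1 of x_k,
  whence the radius R + 2.\<close>

lemma inner_iterates_bound:
  assumes "norm (x k) \<le> R + 1" "norm (vel k) \<le> C * \<alpha>" "j \<le> N"
  shows "norm (w k (Suc j) - w k j) \<le> C * \<alpha> \<and> norm (w k (Suc j) - x k) \<le> real j * C * \<alpha>"
  using assms(3)
proof (induction j)
  case 0
  then show ?case using assms(2) by (simp add: vel_def w_1)
next
  case (Suc j)
  let ?y = "w k (Suc j) + \<gamma> *\<^sub>R (w k (Suc j) - w k j)"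
  have IH: "norm (w k (Suc j) - w k j) \<le> C * \<alpha>" "norm (w k (Suc j) - x k) \<le> real j * C * \<alpha>"
    and j: "j < N" using Suc by auto
  have "norm (?y - x k) \<le> 1" using norm_inner_point_le[OF j IH] C(3) by simp
  then have "norm ?y \<le> R + 2" using assms(1) norm_triangle_sub[of ?y "x k"] by simp
  moreover have "\<sigma> k (Suc j) \<in> {1..N}" using permutes_in_image[OF \<sigma>[of k], of "Suc j"] j by auto
  ultimately have s: "norm (s k j) \<le> L" using L subgrad[OF j] by simp
  have "w k (Suc (Suc j)) - w k (Suc j) = \<beta> *\<^sub>R (w k (Suc j) - w k j) - \<alpha> *\<^sub>R s k j"
    using step[OF j] by simp
  then have "norm (w k (Suc (Suc j)) - w k (Suc j)) \<le>
      \<bar>\<beta>\<bar> * norm (w k (Suc j) - w k j) + \<alpha> * norm (s k j)"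
    using norm_triangle_ineq4[of "\<beta> *\<^sub>R (w k (Suc j) - w k j)" "\<alpha> *\<^sub>R s k j"] \<alpha>_pos by simp
  also have "\<dots> \<le> \<bar>\<beta>\<bar> * (C * \<alpha>) + \<alpha> * L"
    using IH s \<alpha>_pos by (intro add_mono mult_left_mono) auto
  also have "\<dots> = (\<bar>\<beta>\<bar> * C + L) * \<alpha>" by (simp add: algebra_simps)
  also have "\<dots> \<le> C * \<alpha>" using C \<alpha>_pos by (intro mult_right_mono) auto
  finally have 1: "norm (w k (Suc (Suc j)) - w k (Suc j)) \<le> C * \<alpha>" .
  moreover have "norm (w k (Suc (Suc j)) - x k) \<le>
      norm (w k (Suc (Suc j)) - w k (Suc j)) + norm (w k (Suc j) - x k)"
    by (metis norm_triangle_ineq diff_add_cancel add_diff_eq)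
  ultimately show ?case using IH by (simp add: algebra_simps)
qed

text \<open>The case j = N of the inner bounds: the last inner step of an epoch is the velocity with
  which the next one starts.\<close>

lemma outer_step_bound:
  assumes "norm (x k) \<le> R + 1" "norm (vel k) \<le> C * \<alpha>"
  shows "norm (vel (Suc k)) \<le> C * \<alpha>" "norm (x (Suc k) - x k) \<le> real N * C * \<alpha>"
  using inner_iterates_bound[OF assms, of N] by (auto simp: vel_def w_1 w_last w_Suc_0)

text \<open>Up to \<open>kbar\<close> the iterates lie within \<open>R\<close> by assumption, so the
  velocity bound propagates from index 0. Afterwards each epoch moves by at most N C \<alpha>, and
  the budget of 1 covers \<open>K\<close> epochs. Truncated subtraction in \<open>k - kbar\<close>
  joins both phases in one induction.\<close>

lemma outer_iterates_bound:
  assumes "\<forall>k\<le>kbar. norm (x k) \<le> R" "norm (vel 0) \<le> C * \<alpha>"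
    and "real K * (real N * C * \<alpha>) \<le> 1" and "k \<le> kbar + K"
  shows "norm (x k) \<le> R + 1 \<and> norm (vel k) \<le> C * \<alpha>"
proof -
  have mono: "real j * (real N * C * \<alpha>) \<le> 1" if "j \<le> K" for j
  proof -
    have "real j * (real N * C * \<alpha>) \<le> real K * (real N * C * \<alpha>)"
      using that C(1) \<alpha>_pos by (intro mult_right_mono) auto
    then show ?thesis using assms(3) by simp
  qed
  have "norm (x k) \<le> R + real (k - kbar) * (real N * C * \<alpha>) \<and> norm (vel k) \<le> C * \<alpha>"
    using assms(4)
  proof (induction k)
    case 0
    then show ?case using assms by simp
  next
    case (Suc k)
    then have IH: "norm (x k) \<le> R + real (k - kbar) * (real N * C * \<alpha>)" "norm (vel k) \<le> C * \<alpha>" by auto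
    moreover have "k - kbar \<le> K" using Suc.prems by simp
    ultimately have "norm (x k) \<le> R + 1" using mono[of "k - kbar"] by linarith
    note b = outer_step_bound[OF this IH(2)]
    show ?case
    proof (cases "Suc k \<le> kbar")
      case True
      then have "norm (x (Suc k)) \<le> R" using assms(1) by blast
      then show ?thesis using True b by simp
    next
      case False
      then have "real (Suc k - kbar) = real (k - kbar) + 1" by (simp add: Suc_diff_le)
      then show ?thesis
        using IH b norm_triangle_sub[of "x (Suc k)" "x k"] by (simp add: algebra_simps)
    qed
  qed
  moreover have "k - kbar \<le> K" using assms(4) by simp
  ultimately show ?thesis using mono[of "k - kbar"] by linarith
qed

end

end

lemma rrm_sequences_run:
  assumes "x \<in> rrm_sequences \<beta> \<gamma> \<delta> N F \<alpha>" "0 < \<alpha>"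
  obtains w s \<sigma> where "rrm_run F N \<beta> \<gamma> \<alpha> x w s \<sigma>" "norm (x 0 - w 0 0) \<le> \<delta> * \<alpha>"
proof -
  obtain z \<sigma> where z: "norm (z 0 (-1) - x 0) \<le> \<delta> * \<alpha>"
      "\<And>k. z (Suc k) (-1) = z k (int N - 1)" "\<And>k. z k 0 = x k" "\<And>k. \<sigma> k permutes {1..N}"
      "\<And>k. x (Suc k) = z k (int N)"
    and s: "\<And>k i. i \<in> {1..N} \<Longrightarrow>
           let u = z k (int i - 1); v = z k (int i - 2); y = u + \<gamma> *\<^sub>R (u - v)
           in \<exists>s\<in>clarke_subdiff (F (\<sigma> k i)) y. z k (int i) = u + \<beta> *\<^sub>R (u - v) - \<alpha> *\<^sub>R s"
    using assms(1) unfolding rrm_sequences_def by blast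
  define w where "w k j = z k (int j - 1)" for k j
  have "\<forall>k j. \<exists>s. j < N \<longrightarrow>
      s \<in> clarke_subdiff (F (\<sigma> k (Suc j))) (w k (Suc j) + \<gamma> *\<^sub>R (w k (Suc j) - w k j)) \<and>
      w k (Suc (Suc j)) = w k (Suc j) + \<beta> *\<^sub>R (w k (Suc j) - w k j) - \<alpha> *\<^sub>R s"
  proof (intro allI)
    fix k j
    show "\<exists>s. j < N \<longrightarrow>
      s \<in> clarke_subdiff (F (\<sigma> k (Suc j))) (w k (Suc j) + \<gamma> *\<^sub>R (w k (Suc j) - w k j)) \<and>
      w k (Suc (Suc j)) = w k (Suc j) + \<beta> *\<^sub>R (w k (Suc j) - w k j) - \<alpha> *\<^sub>R s"
    proof (cases "j < N")
      case True
      then show ?thesis using s[of "Suc j" k] by (auto simp: w_def Let_def)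
    qed simp
  qed
  then obtain s where "\<And>k j. j < N \<Longrightarrow>
      s k j \<in> clarke_subdiff (F (\<sigma> k (Suc j))) (w k (Suc j) + \<gamma> *\<^sub>R (w k (Suc j) - w k j)) \<and>
      w k (Suc (Suc j)) = w k (Suc j) + \<beta> *\<^sub>R (w k (Suc j) - w k j) - \<alpha> *\<^sub>R s k j"
    by metis
  then have "rrm_run F N \<beta> \<gamma> \<alpha> x w s \<sigma>"
    using z assms(2) by unfold_locales (auto simp: w_def)
  moreover have "norm (x 0 - w 0 0) \<le> \<delta> * \<alpha>" using z(1) by (simp add: w_def norm_minus_commute)
  ultimately show ?thesis using that by blast
qed

subsection \<open>Limits of discrete curves\<close>

text \<open>Constant outside \<open>[0, K]\<close>. The clamps sum up to a single clamp, which yields the Lipschitz bound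
  without any case distinction on \<open>\<lfloor>t\<rfloor>\<close>.\<close>
definition linear_interpolant :: "nat \<Rightarrow> (nat \<Rightarrow> 'a::real_normed_vector) \<Rightarrow> real \<Rightarrow> 'a" where
  "linear_interpolant K u t = u 0 + (\<Sum>k<K. max 0 (min 1 (t - real k)) *\<^sub>R (u (Suc k) - u k))"

lemma linear_interpolant_at_nat:
  assumes "j \<le> K"
  shows "linear_interpolant K u (real j) = u j"
proof -
  have "(\<Sum>k<K. max 0 (min 1 (real j - real k)) *\<^sub>R (u (Suc k) - u k)) =
      (\<Sum>k<K. if k < j then u (Suc k) - u k else 0)"
    by (intro sum.cong) auto
  also have "\<dots> = (\<Sum>k<j. u (Suc k) - u k)"
    using assms by (intro sum.mono_neutral_cong_right) auto
  also have "\<dots> = u j - u 0" by (rule sum_lessThan_telescope)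
  finally show ?thesis by (simp add: linear_interpolant_def)
qed

lemma sum_unit_clamps: "(\<Sum>k<K. max 0 (min 1 (t - real k))) = max 0 (min (real K) (t::real))"
  by (induction K) auto

lemma linear_interpolant_lipschitz:
  assumes "0 \<le> B" "\<And>k. k < K \<Longrightarrow> norm (u (Suc k) - u k) \<le> B"
  shows "B-lipschitz_on UNIV (linear_interpolant K u)"
proof (rule lipschitz_on_leI)
  fix t t' :: real assume "t \<le> t'"
  let ?c = "\<lambda>t k. max 0 (min 1 (t - real k))"
  have "norm (linear_interpolant K u t - linear_interpolant K u t') =
      norm (\<Sum>k<K. (?c t k - ?c t' k) *\<^sub>R (u (Suc k) - u k))"
    by (simp add: linear_interpolant_def sum_subtractf scaleR_diff_left)
  also have "\<dots> \<le> (\<Sum>k<K. norm ((?c t k - ?c t' k) *\<^sub>R (u (Suc k) - u k)))" by (rule norm_sum)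
  also have "\<dots> \<le> (\<Sum>k<K. (?c t' k - ?c t k) * B)"
  proof (rule sum_mono)
    fix k assume "k \<in> {..<K}"
    have "?c t k \<le> ?c t' k" using \<open>t \<le> t'\<close> by auto
    then have "\<bar>?c t k - ?c t' k\<bar> = ?c t' k - ?c t k" by linarith
    then show "norm ((?c t k - ?c t' k) *\<^sub>R (u (Suc k) - u k)) \<le> (?c t' k - ?c t k) * B"
      using assms(2)[of k] \<open>k \<in> {..<K}\<close> \<open>?c t k \<le> ?c t' k\<close>
      by (simp only: norm_scaleR) (intro mult_left_mono, auto)
  qed
  also have "\<dots> = (max 0 (min (real K) t') - max 0 (min (real K) t)) * B"
    by (simp only: sum_distrib_right[symmetric] sum_subtractf sum_unit_clamps)
  also have "\<dots> \<le> (t' - t) * B" using \<open>t \<le> t'\<close> assms(1) by (intro mult_right_mono) auto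
  finally show "dist (linear_interpolant K u t) (linear_interpolant K u t') \<le> B * dist t t'"
    using \<open>t \<le> t'\<close> by (simp add: dist_norm mult.commute)
qed (rule assms)

lemma lipschitz_on_clamp:
  fixes g :: "real \<Rightarrow> 'a::metric_space"
  assumes "B-lipschitz_on {a..b} g" "a \<le> b"
  shows "B-lipschitz_on UNIV (\<lambda>t. g (max a (min b t)))"
proof (rule lipschitz_onI)
  fix s t :: real
  have "dist (g (max a (min b s))) (g (max a (min b t))) \<le>
      B * dist (max a (min b s)) (max a (min b t))"
    using assms by (intro lipschitz_onD) auto
  also have "\<dots> \<le> B * dist s t"
    using lipschitz_on_nonneg[OF assms(1)] by (intro mult_left_mono) (auto simp: dist_real_def)
  finally show "dist (g (max a (min b s))) (g (max a (min b t))) \<le> B * dist s t" .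
qed (use lipschitz_on_nonneg[OF assms(1)] in simp)

text \<open>In the time variable \<open>j * \<alpha> m\<close> all interpolants have the same
  Lipschitz constant \<open>B\<close>, which gives equicontinuity and, with the compact set of
  starting points, boundedness. The limit is extended by constants to the whole line so that
  two-sided derivatives make sense.\<close>

lemma discrete_curves_convergent_subsequence:
  fixes u :: "nat \<Rightarrow> nat \<Rightarrow> 'a::euclidean_space"
  assumes "0 < T" "0 \<le> B" and \<alpha>: "\<And>m. 0 < \<alpha> m"
    and u: "\<And>m j. j < nat \<lfloor>T / \<alpha> m\<rfloor> \<Longrightarrow> norm (u m (Suc j) - u m j) \<le> B * \<alpha> m"
    and X0: "compact X0" "\<And>m. u m 0 \<in> X0"
  obtains x r where "strict_mono (r :: nat \<Rightarrow> nat)" "B-lipschitz_on UNIV x" "x 0 \<in> X0"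
    "\<And>e. 0 < e \<Longrightarrow> \<forall>\<^sub>F m in sequentially.
      \<forall>j\<le>nat \<lfloor>T / \<alpha> (r m)\<rfloor>. norm (u (r m) j - x (real j * \<alpha> (r m))) < e"
proof -
  define K where "K m = nat \<lfloor>T / \<alpha> m\<rfloor>" for m
  define P where "P m t = linear_interpolant (K m) (u m) (t / \<alpha> m)" for m t
  have lip: "B-lipschitz_on UNIV (P m)" for m
  proof -
    have "(B * \<alpha> m)-lipschitz_on UNIV (linear_interpolant (K m) (u m))"
      using u[of _ m] \<alpha>[of m] \<open>0 \<le> B\<close> by (intro linear_interpolant_lipschitz) (auto simp: K_def)
    then have "norm (P m s - P m t) \<le> B * \<alpha> m * \<bar>s / \<alpha> m - t / \<alpha> m\<bar>" for s t
      using lipschitz_onD[of "B * \<alpha> m" UNIV "linear_interpolant (K m) (u m)" "s / \<alpha> m" "t / \<alpha> m"]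
      by (simp add: P_def dist_norm)
    moreover have "\<alpha> m * \<bar>s / \<alpha> m - t / \<alpha> m\<bar> = \<bar>s - t\<bar>" for s t
      using \<alpha>[of m] by (simp add: diff_divide_distrib[symmetric])
    ultimately show ?thesis
      using \<open>0 \<le> B\<close> by (intro lipschitz_onI) (simp_all add: dist_norm mult.assoc)
  qed
  have P_grid: "P m (real j * \<alpha> m) = u m j" if "j \<le> K m" for m j
    using linear_interpolant_at_nat[OF that] \<alpha>[of m] by (simp add: P_def)
  obtain R where R: "\<And>y. y \<in> X0 \<Longrightarrow> norm y \<le> R"
    using compact_imp_bounded[OF X0(1)] bounded_iff by blast
  have bound: "norm (P m t) \<le> R + B * T" if "t \<in> {0..T}" for m t
  proof -
    have "P m 0 = u m 0" using P_grid[of 0 m] by simp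
    moreover have "norm (P m t - P m 0) \<le> B * t"
      using lipschitz_onD[OF lip, of t 0] that by (simp add: dist_norm)
    moreover have "B * t \<le> B * T" using that \<open>0 \<le> B\<close> by (simp add: mult_left_mono)
    ultimately show ?thesis using R[OF X0(2)[of m]] norm_triangle_sub[of "P m t" "P m 0"] by simp
  qed
  have equi: "\<exists>d>0. \<forall>n y. y \<in> {0..T} \<and> norm (t - y) < d \<longrightarrow> norm (P n t - P n y) < e"
    if "t \<in> {0..T}" "0 < e" for t e
  proof (intro exI conjI allI impI)
    \<comment> \<open>\<open>B\<close> may be 0, hence \<open>B + 1\<close>.\<close>
    show "0 < e / (B + 1)" using that \<open>0 \<le> B\<close> by simp
    fix n y assume y: "y \<in> {0..T} \<and> norm (t - y) < e / (B + 1)"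
    have "norm (P n t - P n y) \<le> B * norm (t - y)"
      using lipschitz_onD[OF lip, of t y] by (simp add: dist_norm)
    also have "\<dots> \<le> (B + 1) * norm (t - y)" by (simp add: mult_right_mono)
    also have "\<dots> < e" using y \<open>0 \<le> B\<close> by (simp add: less_divide_eq mult.commute)
    finally show "norm (P n t - P n y) < e" .
  qed
  obtain g r where g: "continuous_on {0..T} g" "strict_mono (r :: nat \<Rightarrow> nat)"
    "\<And>e. 0 < e \<Longrightarrow> \<exists>N. \<forall>n t. n \<ge> N \<and> t \<in> {0..T} \<longrightarrow> norm (P (r n) t - g t) < e"
    using Arzela_Ascoli[OF compact_Icc bound equi] by blast
  have lim: "(\<lambda>n. P (r n) t) \<longlonglongrightarrow> g t" if "t \<in> {0..T}" for t
    unfolding LIMSEQ_iff using g(3) that by meson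
  have "B-lipschitz_on {0..T} g"
  proof (rule lipschitz_onI)
    fix s t assume "s \<in> {0..T}" "t \<in> {0..T}"
    then have "(\<lambda>n. dist (P (r n) s) (P (r n) t)) \<longlonglongrightarrow> dist (g s) (g t)"
      by (intro tendsto_dist lim)
    then show "dist (g s) (g t) \<le> B * dist s t"
      by (rule LIMSEQ_le_const2) (use lipschitz_onD[OF lip] in auto)
  qed fact
  then have lip_x: "B-lipschitz_on UNIV (\<lambda>t. g (max 0 (min T t)))"
    using \<open>0 < T\<close> by (intro lipschitz_on_clamp) auto
  have "P (r n) 0 \<in> X0" for n using P_grid[of 0 "r n"] X0(2)[of "r n"] by simp
  then have "g 0 \<in> X0"
    using closed_sequentially[OF compact_imp_closed[OF X0(1)] _ lim[of 0]] \<open>0 < T\<close> by simp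
  show ?thesis
  proof (rule that[OF g(2) lip_x])
    show "g (max 0 (min T 0)) \<in> X0" using \<open>g 0 \<in> X0\<close> \<open>0 < T\<close> by simp
    fix e :: real assume "0 < e"
    then obtain M where M: "\<And>n t. n \<ge> M \<Longrightarrow> t \<in> {0..T} \<Longrightarrow> norm (P (r n) t - g t) < e"
      using g(3) by blast
    have "norm (u (r m) j - g (max 0 (min T (real j * \<alpha> (r m))))) < e"
      if "m \<ge> M" "j \<le> K (r m)" for m j
    proof -
      have "real j \<le> T / \<alpha> (r m)"
        using that(2) \<open>0 < T\<close> \<alpha>[of "r m"] unfolding K_def by (simp add: le_nat_iff le_floor_iff)
      then have t: "real j * \<alpha> (r m) \<in> {0..T}" using \<alpha>[of "r m"] by (simp add: le_divide_eq)
      then show ?thesis using M[OF that(1) t] P_grid[OF that(2)] by simp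
    qed
    then show "\<forall>\<^sub>F m in sequentially. \<forall>j\<le>nat \<lfloor>T / \<alpha> (r m)\<rfloor>.
        norm (u (r m) j - g (max 0 (min T (real j * \<alpha> (r m))))) < e"
      unfolding eventually_sequentially K_def by blast
  qed
qed

section \<open>The velocity of a limit curve, tested in one direction\<close>

lemma nat_ceiling_grid_tendsto:
  assumes \<alpha>: "\<And>m. 0 < \<alpha> m" "\<alpha> \<longlonglongrightarrow> 0" and "0 \<le> t"
  shows "(\<lambda>m. real (nat \<lceil>t / \<alpha> m\<rceil>) * \<alpha> m) \<longlonglongrightarrow> t"
proof (rule tendsto_sandwich[of "\<lambda>_. t" _ _ "\<lambda>m. t + \<alpha> m"])
  have eq: "real (nat \<lceil>t / \<alpha> m\<rceil>) = real_of_int \<lceil>t / \<alpha> m\<rceil>" for m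
    using \<open>0 \<le> t\<close> \<alpha>(1)[of m] by (simp add: ceiling_le_zero)
  show "\<forall>\<^sub>F m in sequentially. t \<le> real (nat \<lceil>t / \<alpha> m\<rceil>) * \<alpha> m"
  proof (intro always_eventually allI)
    fix m
    have "t / \<alpha> m \<le> real_of_int \<lceil>t / \<alpha> m\<rceil>" by (rule le_of_int_ceiling)
    then show "t \<le> real (nat \<lceil>t / \<alpha> m\<rceil>) * \<alpha> m" 
      unfolding eq pos_divide_le_eq[OF \<alpha>(1)] .
  qed
  show "\<forall>\<^sub>F m in sequentially. real (nat \<lceil>t / \<alpha> m\<rceil>) * \<alpha> m \<le> t + \<alpha> m"
  proof (intro always_eventually allI)
    fix m
    have "real_of_int \<lceil>t / \<alpha> m\<rceil> \<le> t / \<alpha> m + 1" by (rule of_int_ceiling_le_add_one)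
    then have "real_of_int \<lceil>t / \<alpha> m\<rceil> * \<alpha> m \<le> (t / \<alpha> m + 1) * \<alpha> m"
      using \<alpha>(1)[of m] by (intro mult_right_mono) auto
    also have "\<dots> = t + \<alpha> m" using \<alpha>(1)[of m] by (simp add: field_simps)
    finally show "real (nat \<lceil>t / \<alpha> m\<rceil>) * \<alpha> m \<le> t + \<alpha> m" unfolding eq .
  qed
  show "(\<lambda>m. t + \<alpha> m) \<longlonglongrightarrow> t" using tendsto_add[OF tendsto_const \<alpha>(2), of t] by simp
qed simp

text \<open>For a fixed window [t, t + h] the term \<open>E * \<alpha> m\<close> vanishes as m
  grows, leaving (x(t+h) - x(t)) \<bullet> d \<le> h (c + \<eta>). Dividing by h and letting it
  decrease to 0 bounds the derivative. Only windows to the right of t occur, so t = 0 is allowed but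
  t = T is not.\<close>

lemma limit_velocity_inner_le:
  fixes u :: "nat \<Rightarrow> nat \<Rightarrow> 'a::euclidean_space"
  assumes \<alpha>: "\<And>m. 0 < \<alpha> m" "\<alpha> \<longlonglongrightarrow> 0"
    and lim: "\<And>e. 0 < e \<Longrightarrow> \<forall>\<^sub>F m in sequentially.
      \<forall>j\<le>nat \<lfloor>T / \<alpha> m\<rfloor>. norm (u m j - x (real j * \<alpha> m)) < e"
    and cont: "continuous_on UNIV x"
    and t: "0 \<le> t" "t < T" and deriv: "(x has_vector_derivative D) (at t)"
    and incr: "\<And>\<eta>. 0 < \<eta> \<Longrightarrow> \<exists>\<rho>>0. \<forall>\<^sub>F m in sequentially. \<forall>a b. a \<le> b \<longrightarrow> b \<le> nat \<lfloor>T / \<alpha> m\<rfloor> \<longrightarrow>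
      (\<forall>k. a \<le> k \<longrightarrow> k < b \<longrightarrow> dist (u m k) (x t) < \<rho>) \<longrightarrow>
      (u m b - u m a) \<bullet> d \<le> E * \<alpha> m + real (b - a) * \<alpha> m * (c + \<eta>)"
  shows "D \<bullet> d \<le> c"
proof (rule field_le_epsilon)
  fix \<eta> :: real assume "0 < \<eta>"
  then obtain \<rho> where \<rho>: "0 < \<rho>" and bound: "\<forall>\<^sub>F m in sequentially. \<forall>a b. a \<le> b \<longrightarrow> b \<le> nat \<lfloor>T / \<alpha> m\<rfloor> \<longrightarrow>
      (\<forall>k. a \<le> k \<longrightarrow> k < b \<longrightarrow> dist (u m k) (x t) < \<rho>) \<longrightarrow>
      (u m b - u m a) \<bullet> d \<le> E * \<alpha> m + real (b - a) * \<alpha> m * (c + \<eta>)"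
    using incr by blast
  have isC: "isCont x s" for s using cont continuous_on_eq_continuous_at open_UNIV by blast
  \<comment> \<open>Half of \<rho> is spent on the motion of \<open>x\<close> within the window, the
    other half on the distance from \<open>u m\<close> to \<open>x\<close>.\<close>
  obtain h0 where h0: "0 < h0" "\<And>s. dist s t < h0 \<Longrightarrow> dist (x s) (x t) < \<rho> / 2"
    using isC[of t] \<rho> unfolding continuous_at_eps_delta by (metis half_gt_zero)
  have incr_x: "(x (t + h) - x t) \<bullet> d \<le> h * (c + \<eta>)" if h: "0 < h" "h < h0" "t + h < T" for h
  proof -
    \<comment> \<open>Rounding both ends up puts the grid times of all k with
      \<open>a m \<le> k\<close> and \<open>k < b m\<close> into [t, t + h). The strict inequality
      \<open>t + h < T\<close> keeps \<open>b m\<close> within the horizon for large m.\<close>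
    define a b where "a m = nat \<lceil>t / \<alpha> m\<rceil>" and "b m = nat \<lceil>(t + h) / \<alpha> m\<rceil>" for m
    have a: "(\<lambda>m. real (a m) * \<alpha> m) \<longlonglongrightarrow> t" and b: "(\<lambda>m. real (b m) * \<alpha> m) \<longlonglongrightarrow> t + h"
      unfolding a_def b_def using t h by (intro nat_ceiling_grid_tendsto \<alpha>; simp)+
    have ab: "a m \<le> b m" for m
      unfolding a_def b_def using \<alpha>(1)[of m] h by (intro nat_mono ceiling_mono) (simp add: divide_right_mono)
    have bK: "\<forall>\<^sub>F m in sequentially. b m \<le> nat \<lfloor>T / \<alpha> m\<rfloor>"
      using order_tendstoD(2)[OF b h(3)]
    proof eventually_elim
      case (elim m)
      then have "real (b m) \<le> T / \<alpha> m" using \<alpha>(1)[of m] by (simp add: le_divide_eq)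
      then show ?case by (simp add: le_nat_floor)
    qed
    have xlim: "(\<lambda>m. u m (j m)) \<longlonglongrightarrow> x s"
      if "(\<lambda>m. real (j m) * \<alpha> m) \<longlonglongrightarrow> s" "\<forall>\<^sub>F m in sequentially. j m \<le> nat \<lfloor>T / \<alpha> m\<rfloor>" for j s
    proof -
      have "(\<lambda>m. u m (j m) - x (real (j m) * \<alpha> m)) \<longlonglongrightarrow> 0"
      proof (rule tendstoI)
        fix e :: real assume "0 < e"
        from lim[OF this] that(2)
        show "\<forall>\<^sub>F m in sequentially. dist (u m (j m) - x (real (j m) * \<alpha> m)) 0 < e"
          by eventually_elim simp
      qed
      moreover have "(\<lambda>m. x (real (j m) * \<alpha> m)) \<longlonglongrightarrow> x s"
        using isCont_tendsto_compose[OF isC that(1)] .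
      ultimately show ?thesis using tendsto_add by fastforce
    qed
    have aK: "\<forall>\<^sub>F m in sequentially. a m \<le> nat \<lfloor>T / \<alpha> m\<rfloor>"
      by (rule eventually_mono[OF bK]) (use ab order_trans in blast)
    have "\<forall>\<^sub>F m in sequentially. (u m (b m) - u m (a m)) \<bullet> d \<le>
        E * \<alpha> m + (real (b m) * \<alpha> m - real (a m) * \<alpha> m) * (c + \<eta>)"
      using bK bound lim[OF half_gt_zero[OF \<rho>]]
    proof eventually_elim
      case (elim m)
      have "dist (u m k) (x t) < \<rho>" if k: "a m \<le> k" "k < b m" for k
      proof -
        have "t / \<alpha> m \<le> real k" using k(1) unfolding a_def by (simp add: ceiling_le_iff nat_le_iff)
        moreover have "real k < (t + h) / \<alpha> m"
          using k(2) unfolding b_def by (simp add: zless_nat_eq_int_zless less_ceiling_iff)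
        ultimately have "t \<le> real k * \<alpha> m" "real k * \<alpha> m < t + h"
          using \<alpha>(1)[of m] by (simp_all add: divide_le_eq less_divide_eq)
        then have "dist (x (real k * \<alpha> m)) (x t) < \<rho> / 2"
          using h by (intro h0) (simp add: dist_real_def)
        moreover have "dist (u m k) (x (real k * \<alpha> m)) < \<rho> / 2" using elim k by (simp add: dist_norm)
        ultimately show ?thesis by (metis dist_triangle_half_r dist_commute)
      qed
      then have "(u m (b m) - u m (a m)) \<bullet> d \<le> E * \<alpha> m + real (b m - a m) * \<alpha> m * (c + \<eta>)"
        using elim(1,2) ab by blast
      then show ?case using ab[of m] by (simp add: of_nat_diff left_diff_distrib)
    qed
    moreover have "(\<lambda>m. (u m (b m) - u m (a m)) \<bullet> d) \<longlonglongrightarrow> (x (t + h) - x t) \<bullet> d"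
      by (intro tendsto_intros xlim a b aK bK)
    moreover have "(\<lambda>m. E * \<alpha> m + (real (b m) * \<alpha> m - real (a m) * \<alpha> m) * (c + \<eta>))
        \<longlonglongrightarrow> E * 0 + (t + h - t) * (c + \<eta>)"
      by (intro tendsto_intros a b \<alpha>)
    ultimately have "(x (t + h) - x t) \<bullet> d \<le> E * 0 + (t + h - t) * (c + \<eta>)"
      by (intro tendsto_le[OF trivial_limit_sequentially])
    then show ?thesis by simp
  qed
  have "((\<lambda>h. (x (t + h) - x t) /\<^sub>R h) \<longlongrightarrow> D) (at 0)"
  proof (rule LIM_zero_cancel, rule tendsto_norm_zero_cancel)
    have "((\<lambda>h. norm (x (t + h) - x t - h *\<^sub>R D) / norm h) \<longlongrightarrow> 0) (at 0)"
      using deriv unfolding has_vector_derivative_def has_derivative_at by blast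
    then show "((\<lambda>h. norm ((x (t + h) - x t) /\<^sub>R h - D)) \<longlongrightarrow> 0) (at 0)"
    proof (rule Lim_transform_eventually)
      show "\<forall>\<^sub>F h in at 0. norm (x (t + h) - x t - h *\<^sub>R D) / norm h =
          norm ((x (t + h) - x t) /\<^sub>R h - D)"
      proof (rule eventually_at_topological[THEN iffD2], intro exI[of _ UNIV] conjI ballI impI)
        fix h :: real assume "h \<noteq> 0"
        then have "(x (t + h) - x t) /\<^sub>R h - D = (x (t + h) - x t - h *\<^sub>R D) /\<^sub>R h"
          by (simp add: scaleR_diff_right)
        then show "norm (x (t + h) - x t - h *\<^sub>R D) / norm h =
            norm ((x (t + h) - x t) /\<^sub>R h - D)"
          by (simp add: divide_inverse mult.commute)
      qed auto
    qed
  qed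
  then have "((\<lambda>h. ((x (t + h) - x t) /\<^sub>R h) \<bullet> d) \<longlongrightarrow> D \<bullet> d) (at_right 0)"
    by (intro tendsto_inner tendsto_const) (simp add: filterlim_at_split)
  moreover have "\<forall>\<^sub>F h in at_right 0. ((x (t + h) - x t) /\<^sub>R h) \<bullet> d \<le> c + \<eta>"
    unfolding eventually_at_right_field
  proof (intro exI[of _ "min h0 (T - t)"] conjI allI impI)
    show "0 < min h0 (T - t)" using h0 t by simp
    fix h assume "0 < h" "h < min h0 (T - t)"
    then have "(x (t + h) - x t) \<bullet> d \<le> h * (c + \<eta>)" by (intro incr_x) auto
    then show "((x (t + h) - x t) /\<^sub>R h) \<bullet> d \<le> c + \<eta>"
      using \<open>0 < h\<close> by (simp add: divide_inverse_commute[symmetric] divide_le_eq mult.commute)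
  qed
  ultimately show "D \<bullet> d \<le> c + \<eta>" by (rule tendsto_upperbound) simp
qed

subsection \<open>Limits of the method are subgradient trajectories\<close>

lemma lipschitz_imp_absolutely_continuous_on:
  assumes lip: "B-lipschitz_on I x"
  shows "absolutely_continuous_on I x"
  unfolding absolutely_continuous_on_def
proof (intro allI impI)
  fix \<epsilon> :: real assume "0 < \<epsilon>"
  have B: "0 \<le> B" using lip lipschitz_on_nonneg by blast
  show "\<exists>\<delta>>0. \<forall>D. finite D \<longrightarrow> (\<forall>(a, b)\<in>D. a < b \<and> {a..b} \<subseteq> I) \<longrightarrow>
      pairwise (\<lambda>(a, b) (a', b'). disjnt {a<..<b} {a'<..<b'}) D \<longrightarrow>
      (\<Sum>(a, b)\<in>D. b - a) < \<delta> \<longrightarrow> (\<Sum>(a, b)\<in>D. dist (x a) (x b)) < \<epsilon>"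
  proof (intro exI conjI allI impI)
    show "0 < \<epsilon> / (B + 1)" using \<open>0 < \<epsilon>\<close> B by simp
    fix D :: "(real \<times> real) set"
    assume D: "\<forall>(a, b)\<in>D. a < b \<and> {a..b} \<subseteq> I" and le: "(\<Sum>(a, b)\<in>D. b - a) < \<epsilon> / (B + 1)"
    have "(\<Sum>(a, b)\<in>D. dist (x a) (x b)) \<le> (\<Sum>(a, b)\<in>D. B * (b - a))"
    proof (rule sum_mono, clarify)
      fix a b assume "(a, b) \<in> D"
      then have "a < b" "{a..b} \<subseteq> I" using D by auto
      then have "a \<in> I" "b \<in> I" by auto
      then show "dist (x a) (x b) \<le> B * (b - a)"
        using lipschitz_onD[OF lip, of a b] \<open>a < b\<close> by (simp add: dist_real_def)
    qed
    also have "\<dots> = B * (\<Sum>(a, b)\<in>D. b - a)"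
      by (simp add: sum_distrib_left case_prod_beta)
    also have "\<dots> \<le> (B + 1) * (\<Sum>(a, b)\<in>D. b - a)"
      using D by (intro mult_right_mono sum_nonneg) auto
    also have "\<dots> < \<epsilon>" using le B by (simp add: less_divide_eq mult.commute)
    finally show "(\<Sum>(a, b)\<in>D. dist (x a) (x b)) < \<epsilon>" .
  qed
qed

lemma subgradient_trajectory_lipschitzI:
  assumes lip: "B-lipschitz_on UNIV x"
    and vel: "\<And>t D. 0 \<le> t \<Longrightarrow> t < T \<Longrightarrow> (x has_vector_derivative D) (at t) \<Longrightarrow>
      \<exists>s\<in>clarke_subdiff f (x t). D = - (c *\<^sub>R s)"
  shows "subgradient_trajectory f c T x"
  unfolding subgradient_trajectory_def
proof
  show "absolutely_continuous_on {0..T} x"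
    using lipschitz_on_subset[OF lip] by (intro lipschitz_imp_absolutely_continuous_on) auto
  \<comment> \<open>The endpoint \<open>T\<close> is discarded along with the null set because
    velocities are controlled only for t < T.\<close>
  let ?N = "{t. \<not> x differentiable at t} \<union> {T}"
  have "negligible ?N"
    using negligible_non_differentiable_lipschitz[OF lip] by (intro negligible_Un) auto
  then have "AE t in lebesgue. t \<notin> ?N" by (intro AE_not_in) (simp add: negligible_iff_null_sets)
  then have "AE t in lebesgue. t \<in> {0..T} \<longrightarrow>
      (\<exists>s\<in>clarke_subdiff f (x t). (x has_vector_derivative - (c *\<^sub>R s)) (at t within {0..T}))"
  proof (rule AE_mp, intro AE_I2 impI)
    fix t assume "t \<notin> ?N" "t \<in> {0..T}"
    then have "(x has_vector_derivative vector_derivative x (at t)) (at t)" "0 \<le> t" "t < T"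
      using vector_derivative_works by auto
    then show "\<exists>s\<in>clarke_subdiff f (x t). (x has_vector_derivative - (c *\<^sub>R s)) (at t within {0..T})"
      using vel has_vector_derivative_at_within by metis
  qed
  then show "AE t in lebesgue_on {0..T}. \<exists>s\<in>clarke_subdiff f (x t).
      (x has_vector_derivative - (c *\<^sub>R s)) (at t within {0..T})"
    by (subst AE_restrict_space_iff) auto
qed

text \<open>The equation determines the candidate subgradient from \<open>D\<close>; it remains to
  test it in every direction, without splitting it into subgradients of the components.\<close>

lemma average_subgradientI:
  fixes F :: "nat \<Rightarrow> 'a::euclidean_space \<Rightarrow> real"
  assumes "N \<ge> 1" "\<beta> < 1"
    and reg: "\<And>i. i \<in> {1..N} \<Longrightarrow> subdifferentially_regular (F i)"
    and D: "\<And>d l. (\<And>i. i \<in> {1..N} \<Longrightarrow> clarke_dir_deriv (F i) p d = ereal (l i)) \<Longrightarrow>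
      D \<bullet> (- d) \<le> (\<Sum>i=1..N. l i) / (1 - \<beta>)"
  shows "\<exists>s\<in>clarke_subdiff (\<lambda>x. (\<Sum>i=1..N. F i x) / real N) p. D = - ((real N / (1 - \<beta>)) *\<^sub>R s)"
proof
  let ?s = "((1 - \<beta>) / real N) *\<^sub>R (- D)"
  show "D = - ((real N / (1 - \<beta>)) *\<^sub>R ?s)" using assms(1,2) by simp
  show "?s \<in> clarke_subdiff (\<lambda>x. (\<Sum>i=1..N. F i x) / real N) p"
    unfolding clarke_subdiff_def
  proof safe
    fix d
    have "\<forall>i\<in>{1..N}. \<exists>l. clarke_dir_deriv (F i) p d = ereal l"
      using reg unfolding subdifferentially_regular_def by blast
    then obtain l where "\<forall>i\<in>{1..N}. clarke_dir_deriv (F i) p d = ereal (l i)"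
      by (rule bchoice[THEN exE])
    then have l: "clarke_dir_deriv (F i) p d = ereal (l i)" if "i \<in> {1..N}" for i
      using that by blast
    have "?s \<bullet> d = (1 - \<beta>) / real N * (D \<bullet> (- d))" by simp
    also have "\<dots> \<le> (1 - \<beta>) / real N * ((\<Sum>i=1..N. l i) / (1 - \<beta>))"
      using D[OF l] assms(1,2) by (intro mult_left_mono) auto
    also have "\<dots> = (\<Sum>i=1..N. l i) / real N" using assms(2) by simp
    finally have "ereal (?s \<bullet> d) \<le> ereal ((\<Sum>i=1..N. l i) / real N)" by simp
    also have "\<dots> \<le> clarke_dir_deriv (\<lambda>x. (\<Sum>i=1..N. F i x) / real N) p d"
      using reg l by (intro clarke_dir_deriv_average_ge)
    finally show "ereal (?s \<bullet> d) \<le> clarke_dir_deriv (\<lambda>x. (\<Sum>i=1..N. F i x) / real N) p d" .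
  qed
qed

lemma family_inner_le_near:
  assumes "finite I" "0 < \<eta>"
    and "\<And>i. i \<in> I \<Longrightarrow> clarke_dir_deriv (F i) p d = ereal (l i)"
  shows "\<exists>\<rho>>0. \<forall>i\<in>I. \<forall>y\<in>ball p \<rho>. \<forall>s\<in>clarke_subdiff (F i) y. s \<bullet> d \<le> l i + \<eta>"
proof -
  have "\<forall>i\<in>I. \<exists>\<rho>>0. \<forall>y\<in>ball p \<rho>. \<forall>s\<in>clarke_subdiff (F i) y. s \<bullet> d \<le> l i + \<eta>"
    using clarke_subdiff_inner_le_near[OF assms(3,2)] by blast
  then obtain \<rho> where \<rho>: "\<And>i. i \<in> I \<Longrightarrow> 0 < \<rho> i"
    "\<And>i y s. i \<in> I \<Longrightarrow> y \<in> ball p (\<rho> i) \<Longrightarrow> s \<in> clarke_subdiff (F i) y \<Longrightarrow> s \<bullet> d \<le> l i + \<eta>"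
    by metis
  \<comment> \<open>The inserted 1 is a default for empty \<open>I\<close>.\<close>
  let ?r = "Min (insert 1 (\<rho> ` I))"
  have "0 < ?r" using \<rho>(1) \<open>finite I\<close> by (subst Min_gr_iff) auto
  moreover have "?r \<le> \<rho> i" if "i \<in> I" for i using that \<open>finite I\<close> by (intro Min_le) auto
  ultimately show ?thesis using \<rho>(2) by (intro exI[of _ ?r]) (meson mem_ball order_less_le_trans)
qed

lemma rrm_limit_trajectory:
  fixes F :: "nat \<Rightarrow> 'a::euclidean_space \<Rightarrow> real"
  assumes N: "N \<ge> 1" and \<beta>: "\<beta> \<in> {-1<..<1}"
    and reg: "\<forall>i\<in>{1..N}. subdifferentially_regular (F i)"
    and C: "0 < C" "\<bar>\<beta>\<bar> * C + L \<le> C"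
    and L: "\<forall>i\<in>{1..N}. \<forall>y\<in>cball 0 (R + 2). \<forall>s\<in>clarke_subdiff (F i) y. norm s \<le> L"
    and run: "\<And>m. rrm_run F N \<beta> \<gamma> (\<alpha> m) (xs m) (w m) (s m) (\<sigma> m)"
    and \<alpha>: "\<alpha> \<longlonglongrightarrow> 0" "\<And>m. (real N + \<bar>\<gamma>\<bar>) * C * \<alpha> m \<le> 1"
    and init: "\<And>m. norm (xs m 0 - w m 0 0) \<le> C * \<alpha> m"
    and past: "\<And>m. \<forall>k\<le>kbar m. norm (xs m k) \<le> R"
    and X0: "compact X0" "\<And>m. xs m (kbar m) \<in> X0"
    and T: "T = 1 / (real N * C)" and "0 < \<epsilon>"
  shows "\<exists>x m. subgradient_trajectory (\<lambda>x. (\<Sum>i=1..N. F i x) / real N) (real N / (1 - \<beta>)) T x \<and>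
    x 0 \<in> X0 \<and> (\<forall>j\<le>nat \<lfloor>T / \<alpha> m\<rfloor>. norm (xs m (kbar m + j) - x (real j * \<alpha> m)) \<le> \<epsilon>)"
proof -
  define K where "K m = nat \<lfloor>T / \<alpha> m\<rfloor>" for m
  have \<alpha>_pos: "0 < \<alpha> m" for m by (rule rrm_run.\<alpha>_pos[OF run])
  have NC: "0 < real N * C" using N C by simp
  then have "0 < T" using T by simp
  \<comment> \<open>Origin of \<open>T\<close>: an epoch moves by at most N C \<alpha>, so
    T/\<alpha> epochs move by at most T N C = 1.\<close>
  have K_le: "real (K m) * (real N * C * \<alpha> m) \<le> 1" for m
  proof -
    have "real (K m) \<le> T / \<alpha> m" unfolding K_def using \<open>0 < T\<close> \<alpha>_pos[of m] by simp
    then have "real (K m) * (real N * C * \<alpha> m) \<le> T / \<alpha> m * (real N * C * \<alpha> m)"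
      using NC \<alpha>_pos[of m] by (intro mult_right_mono) auto
    also have "\<dots> = 1" using N C(1) \<alpha>_pos[of m] unfolding T by simp
    finally show ?thesis .
  qed
  have bound: "norm (xs m k) \<le> R + 1 \<and> norm (rrm_run.vel (w m) k) \<le> C * \<alpha> m"
    if "k \<le> kbar m + K m" for m k
  proof (rule rrm_run.outer_iterates_bound[OF run[of m] less_imp_le[OF C(1)] C(2) \<alpha>(2) L past])
    show "norm (rrm_run.vel (w m) 0) \<le> C * \<alpha> m"
      using init[of m] rrm_run.w_1[OF run[of m], of 0] by (simp add: rrm_run.vel_def[OF run[of m]])
  qed (use K_le that in auto)
  define u where "u m j = xs m (kbar m + j)" for m j
  have u_step: "norm (u m (Suc j) - u m j) \<le> real N * C * \<alpha> m" if "j < nat \<lfloor>T / \<alpha> m\<rfloor>" for m j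
  proof -
    have "kbar m + j \<le> kbar m + K m" using that by (simp add: K_def)
    note b = bound[OF this]
    show ?thesis
      unfolding u_def add_Suc_right
      by (rule rrm_run.outer_step_bound(2)[OF run[of m] less_imp_le[OF C(1)] C(2) \<alpha>(2) L
            conjunct1[OF b] conjunct2[OF b]])
  qed
  have u_0: "u m 0 \<in> X0" for m using X0(2) by (simp add: u_def)
  obtain x r where r: "strict_mono (r :: nat \<Rightarrow> nat)" and lip: "(real N * C)-lipschitz_on UNIV x"
    and "x 0 \<in> X0" and lim: "\<And>e. 0 < e \<Longrightarrow> \<forall>\<^sub>F m in sequentially.
      \<forall>j\<le>nat \<lfloor>T / \<alpha> (r m)\<rfloor>. norm (u (r m) j - x (real j * \<alpha> (r m))) < e"
    using discrete_curves_convergent_subsequence[where u = u and \<alpha> = \<alpha>,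
        OF \<open>0 < T\<close> less_imp_le[OF NC] \<alpha>_pos u_step X0(1) u_0] by blast
  have \<alpha>r: "(\<lambda>m. \<alpha> (r m)) \<longlonglongrightarrow> 0"
    using LIMSEQ_subseq_LIMSEQ[OF \<alpha>(1) r] by (simp add: o_def)
  \<comment> \<open>The iterates move against the subgradients, so upper bounds on these in
    direction d bound the velocity in direction -d. The value of \<open>E\<close> is the bound on
    the end velocities divided by 1 - \<beta>.\<close>
  have vel: "D \<bullet> (- d) \<le> (\<Sum>i=1..N. l i) / (1 - \<beta>)"
    if t: "0 \<le> t" "t < T" and deriv: "(x has_vector_derivative D) (at t)"
      and l: "\<And>i. i \<in> {1..N} \<Longrightarrow> clarke_dir_deriv (F i) (x t) d = ereal (l i)" for t D d l
  proof (rule limit_velocity_inner_le[OF \<alpha>_pos \<alpha>r lim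
        lipschitz_on_continuous_on[OF lip] t deriv, where E = "2 * C * norm d / (1 - \<beta>)"])
    fix \<eta> :: real assume "0 < \<eta>"
    \<comment> \<open>An epoch collects N errors \<eta>', and the total is divided by 1 - \<beta>;
      the result is \<eta>.\<close>
    define \<eta>' where "\<eta>' = \<eta> * (1 - \<beta>) / real N"
    have "0 < \<eta>'" using \<open>0 < \<eta>\<close> N \<beta> by (simp add: \<eta>'_def)
    from family_inner_le_near[where I = "{1..N}" and F = F and l = l, OF _ this l]
    obtain \<rho> where \<rho>: "0 < \<rho>" "\<forall>i\<in>{1..N}. \<forall>y\<in>ball (x t) \<rho>. \<forall>s\<in>clarke_subdiff (F i) y.
        s \<bullet> d \<le> l i + \<eta>'" by auto
    show "\<exists>\<rho>>0. \<forall>\<^sub>F m in sequentially. \<forall>a b. a \<le> b \<longrightarrow> b \<le> nat \<lfloor>T / \<alpha> (r m)\<rfloor> \<longrightarrow>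
      (\<forall>k. a \<le> k \<longrightarrow> k < b \<longrightarrow> dist (u (r m) k) (x t) < \<rho>) \<longrightarrow>
      (u (r m) b - u (r m) a) \<bullet> (- d) \<le> 2 * C * norm d / (1 - \<beta>) * \<alpha> (r m) +
        real (b - a) * \<alpha> (r m) * ((\<Sum>i=1..N. l i) / (1 - \<beta>) + \<eta>)"
    \<comment> \<open>The other half of \<rho> is for the distance between the evaluation point and
      x_k, which is at most (N + |\<gamma>|) C \<alpha> and tends to 0.\<close>
    proof (intro exI[of _ "\<rho> / 2"] conjI)
      show "0 < \<rho> / 2" using \<rho>(1) by simp
      have "(\<lambda>m. (real N + \<bar>\<gamma>\<bar>) * C * \<alpha> (r m)) \<longlonglongrightarrow> (real N + \<bar>\<gamma>\<bar>) * C * 0"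
        by (intro tendsto_intros \<alpha>r)
      then have "\<forall>\<^sub>F m in sequentially. (real N + \<bar>\<gamma>\<bar>) * C * \<alpha> (r m) < \<rho> / 2"
        using \<rho>(1) by (intro order_tendstoD(2)) auto
      then show "\<forall>\<^sub>F m in sequentially. \<forall>a b. a \<le> b \<longrightarrow> b \<le> nat \<lfloor>T / \<alpha> (r m)\<rfloor> \<longrightarrow>
        (\<forall>k. a \<le> k \<longrightarrow> k < b \<longrightarrow> dist (u (r m) k) (x t) < \<rho> / 2) \<longrightarrow>
        (u (r m) b - u (r m) a) \<bullet> (- d) \<le> 2 * C * norm d / (1 - \<beta>) * \<alpha> (r m) +
          real (b - a) * \<alpha> (r m) * ((\<Sum>i=1..N. l i) / (1 - \<beta>) + \<eta>)"
      proof (eventually_elim, intro allI impI)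
        fix m a b
        let ?m = "r m"
        assume small: "(real N + \<bar>\<gamma>\<bar>) * C * \<alpha> ?m < \<rho> / 2" and "a \<le> b"
          and "b \<le> nat \<lfloor>T / \<alpha> ?m\<rfloor>"
          and near: "\<forall>k. a \<le> k \<longrightarrow> k < b \<longrightarrow> dist (u ?m k) (x t) < \<rho> / 2"
        then have bK: "b \<le> K ?m" by (simp add: K_def)
        have sub: "s ?m k j \<bullet> d \<le> l (\<sigma> ?m k (Suc j)) + \<eta>'"
          if k: "kbar ?m + a \<le> k" "k < kbar ?m + b" and j: "j < N" for k j
        proof -
          let ?y = "w ?m k (Suc j) + \<gamma> *\<^sub>R (w ?m k (Suc j) - w ?m k j)"
          have "k \<le> kbar ?m + K ?m" using k bK by simp
          note bk = bound[OF this]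
          note it = rrm_run.inner_iterates_bound[OF run[of ?m] less_imp_le[OF C(1)] C(2) \<alpha>(2) L
              conjunct1[OF bk] conjunct2[OF bk] less_imp_le[OF j]]
          have "norm (?y - xs ?m k) \<le> (real N + \<bar>\<gamma>\<bar>) * C * \<alpha> ?m"
            using rrm_run.norm_inner_point_le[OF run[of ?m] less_imp_le[OF C(1)] C(2) \<alpha>(2) L j] it by blast
          then have "dist ?y (xs ?m k) < \<rho> / 2" using small by (simp add: dist_norm)
          moreover have "dist (xs ?m k) (x t) < \<rho> / 2"
            using near[rule_format, of "k - kbar ?m"] k by (simp add: u_def)
          ultimately have "?y \<in> ball (x t) \<rho>"
            by (metis dist_commute dist_triangle_half_l mem_ball)
          moreover have "\<sigma> ?m k (Suc j) \<in> {1..N}"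
            using permutes_in_image[OF rrm_run.\<sigma>[OF run[of ?m], of k], of "Suc j"] j by auto
          ultimately show ?thesis using \<rho>(2) rrm_run.subgrad[OF run[of ?m] j] by blast
        qed
        have ab: "kbar ?m + a \<le> kbar ?m + b" and K: "kbar ?m + a \<le> kbar ?m + K ?m"
          "kbar ?m + b \<le> kbar ?m + K ?m"
          using \<open>a \<le> b\<close> bK by auto
        have "- ((1 - \<beta>) * ((u ?m b - u ?m a) \<bullet> d)) \<le> 2 * C * norm d * \<alpha> ?m +
            real (b - a) * \<alpha> ?m * ((\<Sum>i=1..N. l i) + real N * \<eta>')"
          using rrm_run.increment_inner_le[OF run[of ?m] ab \<beta> conjunct2[OF bound[OF K(1)]]
              conjunct2[OF bound[OF K(2)]] sub]
          by (simp add: u_def)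
        also have "real N * \<eta>' = \<eta> * (1 - \<beta>)" using N by (simp add: \<eta>'_def)
        also have "2 * C * norm d * \<alpha> ?m + real (b - a) * \<alpha> ?m * ((\<Sum>i=1..N. l i) + \<eta> * (1 - \<beta>)) =
            (1 - \<beta>) * (2 * C * norm d / (1 - \<beta>) * \<alpha> ?m +
              real (b - a) * \<alpha> ?m * ((\<Sum>i=1..N. l i) / (1 - \<beta>) + \<eta>))"
        proof -
          have "A * y + n * y * (S + \<eta> * q) = q * (A / q * y + n * y * (S / q + \<eta>))"
            if "q \<noteq> 0" for A y n S q :: real
            using that by (simp add: distrib_left)
          then show ?thesis using \<beta> by simp
        qed
        finally have "(1 - \<beta>) * ((u ?m b - u ?m a) \<bullet> (- d)) \<le> (1 - \<beta>) *
            (2 * C * norm d / (1 - \<beta>) * \<alpha> ?m +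
              real (b - a) * \<alpha> ?m * ((\<Sum>i=1..N. l i) / (1 - \<beta>) + \<eta>))" by simp
        then show "(u ?m b - u ?m a) \<bullet> (- d) \<le> 2 * C * norm d / (1 - \<beta>) * \<alpha> ?m +
            real (b - a) * \<alpha> ?m * ((\<Sum>i=1..N. l i) / (1 - \<beta>) + \<eta>)"
          by (rule mult_left_le_imp_le) (use \<beta> in simp)
      qed
    qed
  qed
  have "subgradient_trajectory (\<lambda>x. (\<Sum>i=1..N. F i x) / real N) (real N / (1 - \<beta>)) T x"
  proof (rule subgradient_trajectory_lipschitzI[OF lip])
    fix t D assume t: "0 \<le> t" "t < T" "(x has_vector_derivative D) (at t)"
    show "\<exists>s\<in>clarke_subdiff (\<lambda>x. (\<Sum>i=1..N. F i x) / real N) (x t).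
        D = - ((real N / (1 - \<beta>)) *\<^sub>R s)"
    proof (rule average_subgradientI)
      show "subdifferentially_regular (F i)" if "i \<in> {1..N}" for i using reg that by blast
      show "D \<bullet> (- d) \<le> (\<Sum>i=1..N. l i) / (1 - \<beta>)"
        if "\<And>i. i \<in> {1..N} \<Longrightarrow> clarke_dir_deriv (F i) (x t) d = ereal (l i)" for d l
        using vel[OF t that] .
    qed (use N \<beta> in simp_all)
  qed
  moreover obtain m where "\<forall>j\<le>nat \<lfloor>T / \<alpha> (r m)\<rfloor>. norm (u (r m) j - x (real j * \<alpha> (r m))) < \<epsilon>"
    using eventually_happens[OF lim[OF \<open>0 < \<epsilon>\<close>]] by auto
  ultimately show ?thesis
    using \<open>x 0 \<in> X0\<close> unfolding u_def
    by (intro exI[of _ x] exI[of _ "r m"] conjI allI impI) (simp_all add: less_imp_le)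
qed

section \<open>Choice of the constants and the contradiction\<close>

theorem proposition1:
  fixes F :: "nat \<Rightarrow> 'a::euclidean_space \<Rightarrow> real"
    and N :: nat and \<beta> \<gamma> \<delta> :: real
  assumes "N \<ge> 1"
    and "\<And>i. i \<in> {1..N} \<Longrightarrow> locally_lipschitz (F i)"
    and "\<And>i. i \<in> {1..N} \<Longrightarrow> subdifferentially_regular (F i)"
    and "\<beta> \<in> {-1<..<1}"
    and "\<delta> > 0"
  shows "approximated_by_subgradient_trajectories
           (rrm_method \<beta> \<gamma> \<delta> N F)
           (\<lambda>x. (\<Sum>i=1..N. F i x) / real N)
           (real N / (1 - \<beta>))"
  unfolding approximated_by_subgradient_trajectories_def
proof (intro conjI allI impI)
  show "0 < real N / (1 - \<beta>)" using assms by simp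
  fix X0 X1 :: "'a set" assume "compact X0" "compact X1"
  then obtain R where R: "\<And>y. y \<in> X1 \<Longrightarrow> norm y \<le> R"
    using compact_imp_bounded bounded_iff by metis
  obtain L where L: "0 \<le> L" "\<forall>i\<in>{1..N}. \<forall>y\<in>cball 0 (R + 2). \<forall>s\<in>clarke_subdiff (F i) y. norm s \<le> L"
    using bounded_clarke_subdiff_family[of "{1..N}" F "cball 0 (R + 2)"] assms(2) by auto
  \<comment> \<open>The ball of radius \<open>C * \<alpha>\<close> is invariant under the velocity recursion
    \<open>v \<mapsto> \<beta> *\<^sub>R v - \<alpha> *\<^sub>R s\<close> as long as \<open>norm s \<le> L\<close>.\<close>
  define C where "C = max \<delta> (L / (1 - \<bar>\<beta>\<bar>))"
  have b: "0 < 1 - \<bar>\<beta>\<bar>" using assms(4) by auto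
  have C: "0 < C" "\<delta> \<le> C" using assms(5) by (auto simp: C_def)
  have "L / (1 - \<bar>\<beta>\<bar>) \<le> C" by (simp add: C_def)
  then have CL: "\<bar>\<beta>\<bar> * C + L \<le> C" using b by (simp add: divide_le_eq algebra_simps)
  \<comment> \<open>\<open>T\<close> must be fixed before \<epsilon>. It depends only on N and
    \<open>C\<close>, hence on the data and \<open>X1\<close>.\<close>
  define T where "T = 1 / (real N * C)"
  define \<alpha>0 where "\<alpha>0 = 1 / ((real N + \<bar>\<gamma>\<bar>) * C)"
  have G: "0 < (real N + \<bar>\<gamma>\<bar>) * C" using assms(1) C by simp
  let ?good = "\<lambda>\<epsilon> \<alpha> kbar xs. \<exists>x.
      subgradient_trajectory (\<lambda>x. (\<Sum>i=1..N. F i x) / real N) (real N / (1 - \<beta>)) T x \<and> x 0 \<in> X0 \<and>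
      (\<forall>k\<in>{kbar..kbar + nat \<lfloor>T / \<alpha>\<rfloor>}. norm (xs k - x (real (k - kbar) * \<alpha>)) \<le> \<epsilon>)"
  have main: "\<exists>\<alpha>bar>0. \<forall>\<alpha>\<in>{0<..\<alpha>bar}. \<forall>kbar. \<forall>xs\<in>rrm_method \<beta> \<gamma> \<delta> N F \<alpha> X0 kbar.
      (\<forall>k\<le>kbar. xs k \<in> X1) \<longrightarrow> ?good \<epsilon> \<alpha> kbar xs" if "0 < \<epsilon>" for \<epsilon>
  proof (rule ccontr)
    assume neg: "\<not> ?thesis"
    \<comment> \<open>Dividing by \<open>Suc m\<close> forces the step sizes to 0 and keeps all of
      them below \<open>\<alpha>0\<close>, the threshold at which evaluation points stay within
      distance 1 of x_k.\<close>
    have "\<exists>\<alpha> kbar xs. \<alpha> \<in> {0<..\<alpha>0 / real (Suc m)} \<and> xs \<in> rrm_method \<beta> \<gamma> \<delta> N F \<alpha> X0 kbar \<and>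
        (\<forall>k\<le>kbar. xs k \<in> X1) \<and> \<not> ?good \<epsilon> \<alpha> kbar xs" for m
    proof -
      have "0 < \<alpha>0 / real (Suc m)" using G by (simp add: \<alpha>0_def)
      then show ?thesis using neg by blast
    qed
    then obtain \<alpha> kbar xs where \<alpha>: "\<And>m. \<alpha> m \<in> {0<..\<alpha>0 / real (Suc m)}"
      and xs: "\<And>m. xs m \<in> rrm_method \<beta> \<gamma> \<delta> N F (\<alpha> m) X0 (kbar m)"
      and past: "\<And>m k. k \<le> kbar m \<Longrightarrow> xs m k \<in> X1"
      and bad: "\<And>m. \<not> ?good \<epsilon> (\<alpha> m) (kbar m) (xs m)"
      by metis
    have "\<exists>w s \<sigma>. rrm_run F N \<beta> \<gamma> (\<alpha> m) (xs m) w s \<sigma> \<and> norm (xs m 0 - w 0 0) \<le> \<delta> * \<alpha> m" for m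
    proof -
      have "xs m \<in> rrm_sequences \<beta> \<gamma> \<delta> N F (\<alpha> m)" using xs[of m] by (simp add: rrm_method_def)
      moreover have "0 < \<alpha> m" using \<alpha>[of m] by simp
      ultimately show ?thesis by (rule rrm_sequences_run) blast
    qed
    then obtain w s \<sigma> where run: "\<And>m. rrm_run F N \<beta> \<gamma> (\<alpha> m) (xs m) (w m) (s m) (\<sigma> m)"
      and init: "\<And>m. norm (xs m 0 - w m 0 0) \<le> \<delta> * \<alpha> m"
      by metis
    have \<alpha>_lim: "\<alpha> \<longlonglongrightarrow> 0"
    proof (rule tendsto_sandwich[of "\<lambda>_. 0" _ _ "\<lambda>m. \<alpha>0 / real (Suc m)"])
      show "(\<lambda>m. \<alpha>0 / real (Suc m)) \<longlonglongrightarrow> 0" by (rule lim_const_over_n[THEN LIMSEQ_Suc])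
    qed (use \<alpha> in \<open>auto intro!: always_eventually less_imp_le\<close>)
    have \<alpha>_small: "(real N + \<bar>\<gamma>\<bar>) * C * \<alpha> m \<le> 1" for m
    proof -
      have "\<alpha> m \<le> \<alpha>0 / real (Suc m)" using \<alpha>[of m] by simp
      also have "\<dots> \<le> \<alpha>0 / 1" using G by (intro divide_left_mono) (auto simp: \<alpha>0_def)
      finally have "\<alpha> m \<le> 1 / ((real N + \<bar>\<gamma>\<bar>) * C)" by (simp only: \<alpha>0_def div_by_1)
      then show ?thesis using pos_le_divide_eq[OF G, of "\<alpha> m" 1] by (simp add: mult.commute)
    qed
    \<comment> \<open>Here \<delta> enters the maximum defining \<open>C\<close>: it starts the
      velocity recursion inside the invariant ball.\<close>
    have init': "norm (xs m 0 - w m 0 0) \<le> C * \<alpha> m" for m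
      using init[of m] C(2) \<alpha>[of m] by (meson greaterThanAtMost_iff less_imp_le mult_right_mono order_trans)
    have in_X0: "xs m (kbar m) \<in> X0" for m using xs[of m] by (simp add: rrm_method_def)
    have reg: "\<forall>i\<in>{1..N}. subdifferentially_regular (F i)" using assms(3) by blast
    have past': "\<forall>k\<le>kbar m. norm (xs m k) \<le> R" for m using past R by blast
    obtain x m where x: "subgradient_trajectory (\<lambda>x. (\<Sum>i=1..N. F i x) / real N) (real N / (1 - \<beta>)) T x"
      "x 0 \<in> X0" "\<And>j. j \<le> nat \<lfloor>T / \<alpha> m\<rfloor> \<Longrightarrow> norm (xs m (kbar m + j) - x (real j * \<alpha> m)) \<le> \<epsilon>"
      using rrm_limit_trajectory[OF assms(1,4) reg C(1) CL L(2) run \<alpha>_lim \<alpha>_small init' past'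
          \<open>compact X0\<close> in_X0 T_def \<open>0 < \<epsilon>\<close>] by blast
    have close: "norm (xs m k - x (real (k - kbar m) * \<alpha> m)) \<le> \<epsilon>"
      if "k \<in> {kbar m..kbar m + nat \<lfloor>T / \<alpha> m\<rfloor>}" for k
    proof -
      have "k - kbar m \<le> nat \<lfloor>T / \<alpha> m\<rfloor>" "kbar m + (k - kbar m) = k" using that by auto
      then show ?thesis using x(3)[of "k - kbar m"] by (simp only:)
    qed
    have "?good \<epsilon> (\<alpha> m) (kbar m) (xs m)"
      by (intro exI[of _ x] conjI ballI x(1,2) close)
    with bad[of m] show False ..
  qed
  show "\<exists>T>0. \<forall>\<epsilon>>0. \<exists>\<alpha>bar>0. \<forall>\<alpha>\<in>{0<..\<alpha>bar}. \<forall>kbar. \<forall>xs\<in>rrm_method \<beta> \<gamma> \<delta> N F \<alpha> X0 kbar.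
      (\<forall>k\<le>kbar. xs k \<in> X1) \<longrightarrow>
      (\<exists>x. subgradient_trajectory (\<lambda>x. (\<Sum>i=1..N. F i x) / real N) (real N / (1 - \<beta>)) T x \<and> x 0 \<in> X0 \<and>
        (\<forall>k\<in>{kbar..kbar + nat \<lfloor>T / \<alpha>\<rfloor>}. norm (xs k - x (real (k - kbar) * \<alpha>)) \<le> \<epsilon>))"
  proof (rule exI[of _ T], intro conjI allI impI)
    show "0 < T" using assms(1) C by (simp add: T_def)
  qed (rule main)
qed

end
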